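(* Let $\mu\in\mathcal{M}_{\mathcal{T}}$ be ergodic and set $c:=\int_{\mathbb{S}_d}\int_{[0,1]^d}h(x)\,dx\,d\mu(h)$. Then \[\mu\left(\left\{f\in\mathbb{S}_d\colon \lim_{t\to\infty}\mathcal{Z}_tf=c\cdot\mathbf{1}\right\}\right)=1,\] where the limit is taken in the weak-* topology of $\mathbb{S}_d$ as the real parameter $t\to\infty$.
   Context: $\mathbb{S}_d$ denotes the set of all $f\in L^\infty(\mathbb{R}^d)$ with $0\le f\le1$ almost everywhere, with the weak-* topology inherited from $L^\infty(\mathbb{R}^d)\simeq L^1(\mathbb{R}^d)^*$; $\mathbf{1}$ is the constant function $1$. For $v\in\mathbb{R}^d$, $\mathcal{T}_v\colon\mathbb{S}_d\to\mathbb{S}_d$ is $(\mathcal{T}_vf)(x)=f(x+v)$; for $t>0$, $\mathcal{Z}_t\colon\mathbb{S}_d\to\mathbb{S}_d$ is $(\mathcal{Z}_tf)(x)=f(tx)$. $\mathcal{M}_{\mathcal{T}}$ is the set of Borel probability measures on $\mathbb{S}_d$ invariant under every $\mathcal{T}_v$; such $\mu$ is ergodic if every Borel set $A$ with $\mathcal{T}_vA=A$ up to $\mu$-null sets for all $v\in\mathbb{R}^d$ has $\mu(A)\in\{0,1\}$. *)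

theory Defs
  imports "HOL-Probability.Probability"
begin

text \<open>Representatives of elements of S_d: Borel measurable functions on R^d with
  values in [0,1] everywhere (every class in S_d has such a representative).\<close>
definition Sd :: "(real^'n \<Rightarrow> real) set" where
  "Sd = {f. f \<in> borel_measurable lborel \<and> (\<forall>x. 0 \<le> f x \<and> f x \<le> 1)}"

definition pair_L1 :: "(real^'n \<Rightarrow> real) \<Rightarrow> (real^'n \<Rightarrow> real) \<Rightarrow> real" where
  "pair_L1 f g = (LINT x|lborel. f x * g x)"

text \<open>Borel sigma-algebra of the weak-* topology on S_d: generated by the pairings
  with L^1 functions (the weak-* topology is the initial topology of these maps, and
  S_d is compact metrizable, so the Borel sets are generated by them).  All these
  sets are saturated under almost-everywhere equality.\<close>
definition Sd_measure :: "(real^'n \<Rightarrow> real) measure" where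
  "Sd_measure = sigma Sd
     (\<Union>g\<in>{g. integrable lborel g}. {(\<lambda>f. pair_L1 f g) -` B \<inter> Sd | B. B \<in> sets borel})"

definition transl :: "real^'n \<Rightarrow> (real^'n \<Rightarrow> real) \<Rightarrow> (real^'n \<Rightarrow> real)" where
  "transl v f = (\<lambda>x. f (x + v))"

definition dil :: "real \<Rightarrow> (real^'n \<Rightarrow> real) \<Rightarrow> (real^'n \<Rightarrow> real)" where
  "dil t f = (\<lambda>x. f (t *\<^sub>R x))"

definition transl_invariant :: "(real^'n \<Rightarrow> real) measure \<Rightarrow> bool" where
  "transl_invariant M \<longleftrightarrow> prob_space M \<and> sets M = sets Sd_measure \<and>
     (\<forall>v. transl v \<in> M \<rightarrow>\<^sub>M M \<and> distr M M (transl v) = M)"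

definition ergodic_transl :: "(real^'n \<Rightarrow> real) measure \<Rightarrow> bool" where
  "ergodic_transl M \<longleftrightarrow> transl_invariant M \<and>
     (\<forall>A\<in>sets M. (\<forall>v. ((transl v -` A \<inter> space M) - A) \<union> (A - (transl v -` A \<inter> space M))
                         \<in> null_sets M)
        \<longrightarrow> measure M A = 0 \<or> measure M A = 1)"

definition weak_star_tendsto_const :: "(real^'n \<Rightarrow> real) \<Rightarrow> real \<Rightarrow> bool" where
  "weak_star_tendsto_const f c \<longleftrightarrow>
     (\<forall>g. integrable lborel g \<longrightarrow>
        ((\<lambda>t. pair_L1 (dil t f) g) \<longlongrightarrow> pair_L1 (\<lambda>_. c) g) at_top)"

end

(* By convexity and the ergodic hypothesis, convex combinations G of translates of the unit cell
   average f |-> int_[0,1]^d f come arbitrarily close to the constant c in L^1(M).  Over a large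
   dilated box, G and the unit cell average have the same lattice averages up to a vanishing boundary
   error, uniformly in f, so only the average of |G - c| has to be controlled.  A maximal inequality for
   Z^d does this, and along a fast sequence of such G Borel-Cantelli gives almost sure convergence of
   all box averages.  Box indicators are dense in L^1; as M need not be complete, the measurability of
   the event is obtained by reducing weak-* convergence to rational boxes and integer dilations. *)
theory Submission
  imports Defs
begin

section \<open>A maximal inequality for Z^d\<close>

text \<open>Ergodicity is assumed for translations by all of R^d and need not pass to the lattice
  Z^d, whereas averages over the continuous group would call for joint measurability in the
  translation vector and the function. The proof therefore gives the two groups different tasks.
  Ergodicity under real translations is spent in \<open>mean_ergodic_midpoint_family\<close>, which
  only has to produce one functional close to c in L^1(M). Pointwise control then rests on integer
  translations and the invariance of M, through sums over finite sets of lattice points. The link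
  between the two is \<open>box_averaging\<close>: it holds for every \<open>f\<close> in
  \<open>Sd\<close>, so replacing the unit cell average by G costs no exceptional set. Because the
  maximal event involves cubes of all radii at once, a functional chosen in advance controls every
  large real t.\<close>

definition icube :: "('n \<Rightarrow> int) \<Rightarrow> nat \<Rightarrow> ('n \<Rightarrow> int) set" where
  "icube k n = {j. \<forall>i. \<bar>j i - k i\<bar> \<le> int n}"

lemma icube_eq_PiE: "icube k n = (\<Pi>\<^sub>E i\<in>UNIV. {k i - int n..k i + int n})"
  by (auto simp: icube_def PiE_iff abs_le_iff algebra_simps)

lemma finite_icube [simp]: "finite (icube (k :: 'n::finite \<Rightarrow> int) n)"
  unfolding icube_eq_PiE by (rule finite_PiE) auto

lemma card_icube: "card (icube (k :: 'n::finite \<Rightarrow> int) n) = (2 * n + 1) ^ CARD('n)"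
proof -
  have "nat (2 * int n + 1) = 2 * n + 1" by simp
  then show ?thesis
    unfolding icube_eq_PiE by (subst card_PiE) (auto simp: algebra_simps)
qed

lemma sum_icube_shift: "(\<Sum>j\<in>icube k n. u j) = (\<Sum>j\<in>icube (\<lambda>_. 0) n. u (\<lambda>i. j i + k i))"
  by (rule sum.reindex_bij_witness[of _ "\<lambda>j i. j i + k i" "\<lambda>j i. j i - k i"])
    (auto simp: icube_def)

text \<open>Vitali's greedy selection: a cube of maximal radius is chosen, and the cubes meeting it have
  their centres in its double.\<close>
lemma card_le_sum_of_dense_icubes:
  fixes u :: "('n::finite \<Rightarrow> int) \<Rightarrow> real"
  assumes "finite D" "finite E" and "\<And>j. 0 \<le> u j" and "0 \<le> l"
    and "\<And>k. k \<in> D \<Longrightarrow> icube k (r k) \<subseteq> E"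
    and "\<And>k. k \<in> D \<Longrightarrow> l * real (2 * r k + 1) ^ CARD('n) \<le> (\<Sum>j\<in>icube k (r k). u j)"
  shows "l * card D \<le> 2 ^ CARD('n) * (\<Sum>j\<in>E. u j)"
  using assms
proof (induction "card D" arbitrary: D E rule: less_induct)
  case less
  show ?case
  proof (cases "D = {}")
    case True
    then show ?thesis using less.prems(3) by (simp add: sum_nonneg)
  next
    case False
    have "Max (r ` D) \<in> r ` D" using False less.prems(1) by (intro Max_in) auto
    then obtain k where k: "k \<in> D" and "r k = Max (r ` D)" by auto
    then have kmax: "r j \<le> r k" if "j \<in> D" for j using that less.prems(1) by simp
    define C where "C = icube k (r k)"
    \<comment> \<open>The cubes indexed by \<open>D'\<close> miss \<open>C\<close>, so the induction
      hypothesis applies with \<open>C\<close> taken out of \<open>E\<close>, and the two sums of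
      \<open>u\<close> add without overlap.\<close>
    define D' where "D' = {j \<in> D. icube j (r j) \<inter> C = {}}"
    have "k \<in> icube k (r k)" by (simp add: icube_def)
    then have "k \<notin> D'" using k by (auto simp: D'_def C_def)
    have "card D' < card D"
      by (rule psubset_card_mono) (use \<open>k \<notin> D'\<close> k less.prems(1) in \<open>auto simp: D'_def\<close>)
    then have IH: "l * card D' \<le> 2 ^ CARD('n) * (\<Sum>j\<in>E - C. u j)"
      by (rule less.hyps) (use less.prems in \<open>auto simp: D'_def\<close>)
    have "D - D' \<subseteq> icube k (2 * r k)"
    proof
      fix j assume j: "j \<in> D - D'"
      then obtain x where x: "x \<in> icube j (r j)" "x \<in> C" by (auto simp: D'_def)
      have "r j \<le> r k" using j kmax by auto
      have "\<bar>j i - k i\<bar> \<le> int (2 * r k)" for i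
      proof -
        have "\<bar>x i - j i\<bar> \<le> int (r j)" "\<bar>x i - k i\<bar> \<le> int (r k)"
          using x by (auto simp: C_def icube_def)
        then show ?thesis using \<open>r j \<le> r k\<close> by linarith
      qed
      then show "j \<in> icube k (2 * r k)" by (simp add: icube_def)
    qed
    then have "card (D - D') \<le> (2 * (2 * r k) + 1) ^ CARD('n)"
      by (metis card_icube card_mono finite_icube)
    \<comment> \<open>The doubled cube has side \<open>4 * r k + 1\<close>, less than twice the side
      of \<open>C\<close>. Only the centres of the discarded cubes are counted, hence a factor 2 per
      dimension where covering the cubes themselves would give 3.\<close>
    also have "\<dots> \<le> (2 * (2 * r k + 1)) ^ CARD('n)" by (rule power_mono) auto
    finally have "real (card (D - D')) \<le> real ((2 * (2 * r k + 1)) ^ CARD('n))" by (rule of_nat_mono)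
    also have "\<dots> = 2 ^ CARD('n) * real (2 * r k + 1) ^ CARD('n)"
      by (simp add: power_mult_distrib[symmetric])
    finally have "l * card (D - D') \<le> l * (2 ^ CARD('n) * real (2 * r k + 1) ^ CARD('n))"
      using less.prems(4) by (rule mult_left_mono)
    also have "\<dots> = 2 ^ CARD('n) * (l * real (2 * r k + 1) ^ CARD('n))" by (rule mult.left_commute)
    also have "\<dots> \<le> 2 ^ CARD('n) * (\<Sum>j\<in>C. u j)"
      unfolding C_def by (rule mult_left_mono[OF less.prems(6)[OF k]]) simp
    finally have D: "l * card (D - D') \<le> 2 ^ CARD('n) * (\<Sum>j\<in>C. u j)" .
    have "D' \<subseteq> D" by (auto simp: D'_def)
    then have "card D = card (D - D') + card D'"
      using less.prems(1) by (metis card_Diff_subset card_mono finite_subset le_add_diff_inverse2)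
    then have "l * card D = l * card (D - D') + l * card D'" by (simp add: distrib_left)
    also have "\<dots> \<le> 2 ^ CARD('n) * ((\<Sum>j\<in>C. u j) + (\<Sum>j\<in>E - C. u j))"
      using D IH by (simp add: distrib_left)
    also have "(\<Sum>j\<in>C. u j) + (\<Sum>j\<in>E - C. u j) = (\<Sum>j\<in>E. u j)"
      using sum.subset_diff[of C E u] less.prems(2,5) k by (simp add: C_def)
    finally show ?thesis .
  qed
qed

text \<open>Transference: along the orbit of \<open>x\<close>, the indices \<open>k\<close> in a
  large cube for which \<open>T k x\<close> is bad carry witness cubes, to which the covering lemma
  applies. Integrating and using invariance turns the count into a probability and the orbit sum
  into an expectation. The constant \<open>4 ^ CARD('n)\<close> is the product of the covering
  constant \<open>2 ^ CARD('n)\<close> and the bound \<open>2 ^ CARD('n)\<close> for the ratio of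
  the sizes of the cubes of radii \<open>2 * N\<close> and \<open>N\<close>.\<close>

theorem (in prob_space) maximal_inequality_icube:
  fixes T :: "('n::finite \<Rightarrow> int) \<Rightarrow> 'a \<Rightarrow> 'a" and U :: "'a \<Rightarrow> real"
  assumes T [measurable]: "\<And>k. T k \<in> M \<rightarrow>\<^sub>M M"
    and distr: "\<And>k. distr M M (T k) = M"
    and act: "\<And>j k x. x \<in> space M \<Longrightarrow> T j (T k x) = T (\<lambda>i. j i + k i) x"
    and U: "integrable M U" "\<And>x. 0 \<le> U x" and l: "0 < l"
  shows "prob {x \<in> space M. \<exists>n. l * real (2 * n + 1) ^ CARD('n) < (\<Sum>k\<in>icube (\<lambda>_. 0) n. U (T k x))}
    \<le> 4 ^ CARD('n) * expectation U / l"
proof -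
  have [measurable]: "U \<in> borel_measurable M" using U by simp
  have EU: "integrable M (\<lambda>x. U (T k x))" "expectation (\<lambda>x. U (T k x)) = expectation U" for k
    using integrable_distr[OF T[of k], of U] integral_distr[OF T[of k], of U] U(1) distr by simp_all
  define good where "good n x \<longleftrightarrow> l * real (2 * n + 1) ^ CARD('n) < (\<Sum>k\<in>icube (\<lambda>_. 0) n. U (T k x))" for n x
  have [measurable]: "Measurable.pred M (good n)" for n unfolding good_def by measurable
  \<comment> \<open>The truncation radius is also the radius of the window of indices, so every
    witness cube lies within radius \<open>2 * N\<close> and the estimate does not depend on
    \<open>N\<close>.\<close>
  define B where "B N = {x \<in> space M. \<exists>n\<le>N. good n x}" for N
  have B [measurable]: "B N \<in> sets M" for N unfolding B_def by measurable
  have bound: "prob (B N) \<le> 4 ^ CARD('n) * expectation U / l" for N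
  proof -
    have pointwise: "l * (\<Sum>k\<in>icube (\<lambda>_. 0) N. indicator (B N) (T k x))
        \<le> 2 ^ CARD('n) * (\<Sum>j\<in>icube (\<lambda>_. 0) (2 * N). U (T j x))" if x: "x \<in> space M" for x
    proof -
      define D where "D = {k \<in> icube (\<lambda>_. 0) N. T k x \<in> B N}"
      have "\<forall>k\<in>D. \<exists>n\<le>N. good n (T k x)" by (auto simp: D_def B_def)
      then obtain r where r: "\<And>k. k \<in> D \<Longrightarrow> r k \<le> N \<and> good (r k) (T k x)" by metis
      have "l * card D \<le> 2 ^ CARD('n) * (\<Sum>j\<in>icube (\<lambda>_. 0) (2 * N). U (T j x))"
      proof (rule card_le_sum_of_dense_icubes[where r = r])
        show "finite D" by (simp add: D_def)
        show "0 \<le> l" using l by simp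
        fix k assume k: "k \<in> D"
        show "icube k (r k) \<subseteq> icube (\<lambda>_. 0) (2 * N)"
        proof
          fix j assume j: "j \<in> icube k (r k)"
          have "\<bar>j i\<bar> \<le> int (2 * N)" for i
          proof -
            have "\<bar>j i - k i\<bar> \<le> int (r k)" "\<bar>k i\<bar> \<le> int N" "r k \<le> N"
              using j k r[OF k] by (auto simp: icube_def D_def)
            then show ?thesis by linarith
          qed
          then show "j \<in> icube (\<lambda>_. 0) (2 * N)" by (simp add: icube_def)
        qed
        have "l * real (2 * r k + 1) ^ CARD('n) < (\<Sum>j\<in>icube (\<lambda>_. 0) (r k). U (T j (T k x)))"
          using r[OF k] by (simp add: good_def)
        also have "\<dots> = (\<Sum>j\<in>icube k (r k). U (T j x))"
          unfolding sum_icube_shift[of _ k] by (simp add: act[OF x])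
        finally show "l * real (2 * r k + 1) ^ CARD('n) \<le> (\<Sum>j\<in>icube k (r k). U (T j x))" by simp
      qed (use U in auto)
      moreover have "(\<Sum>k\<in>icube (\<lambda>_. 0) N. indicator (B N) (T k x)) = real (card D)"
        unfolding D_def indicator_def by (simp add: sum.If_cases Int_def)
      ultimately show ?thesis by simp
    qed
    have EB: "expectation (\<lambda>x. indicator (B N) (T k x)) = prob (B N)" for k
      using integral_distr[OF T[of k], of "indicator (B N) :: _ \<Rightarrow> real"] distr by simp
    have intB: "integrable M (\<lambda>x. indicator (B N) (T k x) :: real)" for k
      by (rule integrable_const_bound[where B = 1]) (auto split: split_indicator)
    have "l * (real (2 * N + 1) ^ CARD('n) * prob (B N))
        = expectation (\<lambda>x. l * (\<Sum>k\<in>icube (\<lambda>_. 0) N. indicator (B N) (T k x)))"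
      using intB by (simp add: EB card_icube)
    also have "\<dots> \<le> expectation (\<lambda>x. 2 ^ CARD('n) * (\<Sum>j\<in>icube (\<lambda>_. 0) (2 * N). U (T j x)))"
      by (intro integral_mono pointwise) (auto intro!: intB EU)
    also have "\<dots> = 2 ^ CARD('n) * (real (4 * N + 1) ^ CARD('n) * expectation U)"
      using EU by (simp add: card_icube)
    also have "\<dots> \<le> 2 ^ CARD('n) * (real (2 * (2 * N + 1)) ^ CARD('n) * expectation U)"
      using U(2) by (intro mult_left_mono mult_right_mono power_mono Bochner_Integration.integral_nonneg) auto
    also have "\<dots> = real (2 * N + 1) ^ CARD('n) * (4 ^ CARD('n) * expectation U)"
    proof -
      have "2 ^ CARD('n) * real (2 * (2 * N + 1)) ^ CARD('n) = real (2 * N + 1) ^ CARD('n) * 4 ^ CARD('n)"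
        by (simp add: algebra_simps flip: power_mult_distrib)
      then show ?thesis by (simp only: mult.assoc[symmetric])
    qed
    finally have "real (2 * N + 1) ^ CARD('n) * (l * prob (B N))
        \<le> real (2 * N + 1) ^ CARD('n) * (4 ^ CARD('n) * expectation U)"
      by (simp only: mult.left_commute)
    then have "l * prob (B N) \<le> 4 ^ CARD('n) * expectation U"
      by (rule mult_left_le_imp_le) simp
    then show ?thesis using l by (simp add: field_simps)
  qed
  have "(\<lambda>N. prob (B N)) \<longlonglongrightarrow> prob (\<Union>N. B N)"
    by (rule finite_Lim_measure_incseq) (auto simp: incseq_def B_def intro: order_trans)
  then have "prob (\<Union>N. B N) \<le> 4 ^ CARD('n) * expectation U / l"
    by (rule LIMSEQ_le_const2) (use bound in auto)
  also have "(\<Union>N. B N) = {x \<in> space M. \<exists>n. good n x}" by (auto simp: B_def)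
  finally show ?thesis by (simp add: good_def)
qed

section \<open>Mean ergodic approximation\<close>

text \<open>The variance of \<open>\<bar>X n\<bar>\<close> is nonnegative, so a second moment bound
  gives an L^1 bound; the sum of the absolute values then has a finite integral.\<close>

lemma (in prob_space) AE_summable_of_expectation_le:
  fixes X :: "nat \<Rightarrow> 'a \<Rightarrow> real"
  assumes "\<And>n. integrable M (X n)" and "\<And>n. expectation (\<lambda>x. (X n x)\<^sup>2) \<le> (b n)\<^sup>2" "\<And>n. 0 \<le> b n"
    and "\<And>n. integrable M (\<lambda>x. (X n x)\<^sup>2)" and "summable b"
  shows "AE x in M. summable (\<lambda>n. X n x)"
proof -
  have [measurable]: "X n \<in> borel_measurable M" for n using assms(1) by simp
  have "expectation (\<lambda>x. \<bar>X n x\<bar>) \<le> b n" for n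
  proof -
    have "(expectation (\<lambda>x. \<bar>X n x\<bar>))\<^sup>2 \<le> expectation (\<lambda>x. \<bar>X n x\<bar>\<^sup>2)"
      using variance_positive[of "\<lambda>x. \<bar>X n x\<bar>"] assms(1,4) by (subst (asm) variance_eq) auto
    also have "\<dots> \<le> (b n)\<^sup>2" using assms(2) by simp
    finally show ?thesis using assms(3) by (rule power2_le_imp_le)
  qed
  then have "(\<integral>\<^sup>+x. ennreal \<bar>X n x\<bar> \<partial>M) \<le> ennreal (b n)" for n
    by (subst nn_integral_eq_integral) (auto intro!: assms(1) ennreal_leI integrable_abs)
  then have "(\<Sum>n. \<integral>\<^sup>+x. ennreal \<bar>X n x\<bar> \<partial>M) \<le> (\<Sum>n. ennreal (b n))"
    by (intro suminf_le) auto
  also have "\<dots> = ennreal (\<Sum>n. b n)" using assms(3,5) by (rule suminf_ennreal2)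
  also have "\<dots> < \<infinity>" by simp
  finally have "(\<integral>\<^sup>+x. (\<Sum>n. ennreal \<bar>X n x\<bar>) \<partial>M) \<noteq> \<infinity>" by (simp add: nn_integral_suminf)
  then have "AE x in M. (\<Sum>n. ennreal \<bar>X n x\<bar>) \<noteq> \<infinity>" by (intro nn_integral_noteq_infinite) auto
  then show ?thesis
  proof eventually_elim
    case (elim x)
    then have "summable (\<lambda>n. \<bar>X n x\<bar>)" by (intro summable_suminf_not_top) auto
    then show ?case by (rule summable_rabs_cancel)
  qed
qed

text \<open>Zero-one law for one level set suffices: whichever way it goes, the function is almost surely
  on one side of its mean.\<close>
lemma (in prob_space) AE_eq_expectation_if_invariant:
  fixes G :: "'a \<Rightarrow> real"
  assumes T: "\<And>v. T v \<in> M \<rightarrow>\<^sub>M M"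
    and erg: "\<And>A. A \<in> events \<Longrightarrow>
      (\<And>v. ((T v -` A \<inter> space M) - A) \<union> (A - (T v -` A \<inter> space M)) \<in> null_sets M) \<Longrightarrow>
      prob A = 0 \<or> prob A = 1"
    and G: "integrable M G" and inv: "\<And>v. AE x in M. G (T v x) = G x"
  shows "AE x in M. G x = expectation G"
proof -
  have [measurable]: "G \<in> borel_measurable M" using G by simp
  note [measurable] = T
  define e where "e = expectation G"
  define A where "A = {x \<in> space M. e < G x}"
  have A: "A \<in> events" unfolding A_def by measurable
  have "prob A = 0 \<or> prob A = 1"
  proof (rule erg[OF A])
    fix v
    let ?D = "((T v -` A \<inter> space M) - A) \<union> (A - (T v -` A \<inter> space M))"
    have "?D \<in> sets M" using measurable_sets[OF T A] A by auto
    moreover have "AE x in M. x \<notin> ?D"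
      using inv[of v] AE_space
    proof eventually_elim
      case (elim x)
      then have "T v x \<in> space M" using measurable_space[OF T] by blast
      with elim show ?case by (auto simp: A_def)
    qed
    ultimately show "?D \<in> null_sets M" using AE_iff_null_sets by blast
  qed
  then consider "AE x in M. G x \<le> e" | "AE x in M. e \<le> G x"
  proof
    assume "prob A = 0"
    then have "AE x in M. x \<notin> A" using prob_eq_0[OF A] by simp
    then have "AE x in M. G x \<le> e" using AE_space by eventually_elim (auto simp: A_def)
    then show ?thesis using that by blast
  next
    assume "prob A = 1"
    then have "AE x in M. x \<in> A" by (rule AE_prob_1)
    then have "AE x in M. e \<le> G x" by eventually_elim (auto simp: A_def)
    then show ?thesis using that by blast
  qed
  then show ?thesis
  proof cases
    case 1
    have int: "integrable M (\<lambda>x. e - G x)" using G by simp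
    have "expectation (\<lambda>x. e - G x) = 0" using G by (simp add: e_def prob_space)
    moreover have "AE x in M. 0 \<le> e - G x" using 1 by eventually_elim simp
    ultimately have "AE x in M. e - G x = 0" using integral_nonneg_eq_0_iff_AE[OF int] by blast
    then show ?thesis unfolding e_def by eventually_elim simp
  next
    case 2
    have int: "integrable M (\<lambda>x. G x - e)" using G by simp
    have "expectation (\<lambda>x. G x - e) = 0" using G by (simp add: e_def prob_space)
    moreover have "AE x in M. 0 \<le> G x - e" using 2 by eventually_elim simp
    ultimately have "AE x in M. G x - e = 0" using integral_nonneg_eq_0_iff_AE[OF int] by blast
    then show ?thesis unfolding e_def by eventually_elim simp
  qed
qed

text \<open>Von Neumann's argument: a sequence in the family that minimises the second moment is Cauchy by
  the parallelogram law, and for the same reason asymptotically invariant.\<close>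
theorem (in prob_space) mean_ergodic_midpoint_family:
  fixes F :: "('a \<Rightarrow> real) set"
  assumes T [measurable]: "\<And>v. T v \<in> M \<rightarrow>\<^sub>M M"
    and distr: "\<And>v. distr M M (T v) = M"
    and erg: "\<And>A. A \<in> events \<Longrightarrow>
      (\<And>v. ((T v -` A \<inter> space M) - A) \<union> (A - (T v -` A \<inter> space M)) \<in> null_sets M) \<Longrightarrow>
      prob A = 0 \<or> prob A = 1"
    and ne: "F \<noteq> {}"
    and meas: "\<And>G. G \<in> F \<Longrightarrow> G \<in> borel_measurable M"
    and unit: "\<And>G x. G \<in> F \<Longrightarrow> x \<in> space M \<Longrightarrow> G x \<in> {0..1}"
    and mean: "\<And>G. G \<in> F \<Longrightarrow> expectation G = c"
    and shift: "\<And>G v. G \<in> F \<Longrightarrow> (\<lambda>x. G (T v x)) \<in> F"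
    and mid: "\<And>G H. G \<in> F \<Longrightarrow> H \<in> F \<Longrightarrow> (\<lambda>x. (G x + H x) / 2) \<in> F"
    and "0 < \<epsilon>"
  shows "\<exists>G\<in>F. expectation (\<lambda>x. \<bar>G x - c\<bar>) < \<epsilon>"
proof -
  define sq where "sq G = expectation (\<lambda>x. (G x)\<^sup>2)" for G :: "'a \<Rightarrow> real"
  define \<delta> where "\<delta> = Inf (sq ` F)"
  have bdd: "bdd_below (sq ` F)" by (rule bdd_belowI[of _ 0]) (auto simp: sq_def)
  have \<delta>_le: "\<delta> \<le> sq G" if "G \<in> F" for G :: "'a \<Rightarrow> real"
    unfolding \<delta>_def using bdd that by (simp add: cInf_lower)
  have int1: "integrable M G" if "G \<in> F" for G :: "'a \<Rightarrow> real"
  proof (rule integrable_const_bound[where B = 1])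
    show "AE x in M. norm (G x) \<le> 1" using unit[OF that] by (intro AE_I2) auto
  qed (rule meas[OF that])
  have int2: "integrable M (\<lambda>x. G x * H x)" if "G \<in> F" "H \<in> F" for G H
  proof (rule integrable_const_bound[where B = 1])
    show "AE x in M. norm (G x * H x) \<le> 1"
    proof (rule AE_I2)
      fix x assume "x \<in> space M"
      then have "0 \<le> G x" "G x \<le> 1" "0 \<le> H x" "H x \<le> 1" using unit that by auto
      then show "norm (G x * H x) \<le> 1" by (simp add: abs_mult mult_le_one)
    qed
    show "(\<lambda>x. G x * H x) \<in> borel_measurable M"
      using meas that by (intro borel_measurable_times)
  qed
  have int2': "integrable M (\<lambda>x. (G x - H x)\<^sup>2)" if "G \<in> F" "H \<in> F" for G H
    using int2[OF that(1,1)] int2[OF that(2,2)] int2[OF that]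
    by (simp add: power2_diff mult.assoc flip: power2_eq_square)
  have parallelogram: "expectation (\<lambda>x. (G x - H x)\<^sup>2) \<le> 2 * sq G + 2 * sq H - 4 * \<delta>"
    if "G \<in> F" "H \<in> F" for G H
  proof -
    have int: "integrable M (\<lambda>x. 2 * (G x)\<^sup>2)" "integrable M (\<lambda>x. 2 * (H x)\<^sup>2)"
      "integrable M (\<lambda>x. 4 * ((G x + H x) / 2)\<^sup>2)"
      unfolding power2_eq_square by (intro integrable_mult_right int2 mid that)+
    have "(G x - H x)\<^sup>2 = 2 * (G x)\<^sup>2 + 2 * (H x)\<^sup>2 - 4 * ((G x + H x) / 2)\<^sup>2" for x
      by (simp add: power2_eq_square field_simps)
    then have "expectation (\<lambda>x. (G x - H x)\<^sup>2) = 2 * sq G + 2 * sq H - 4 * sq (\<lambda>x. (G x + H x) / 2)"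
      using int by (simp only: sq_def Bochner_Integration.integral_diff Bochner_Integration.integral_add
          Bochner_Integration.integrable_add integral_mult_right_zero)
    with \<delta>_le[OF mid[OF that]] show ?thesis by simp
  qed
  \<comment> \<open>By \<open>parallelogram\<close>, two members whose second moments are within
    \<open>(1 / 16) ^ n\<close> of the infimum differ by at most \<open>2 * (1 / 4) ^ n\<close> in
    L^2. The rate is chosen to make this bound summable, so almost sure convergence follows for the
    sequence itself, with no passage to a subsequence.\<close>
  have "\<exists>G\<in>F. sq G < \<delta> + (1 / 16) ^ n" for n :: nat
    using cInf_lessD[of "sq ` F" "\<delta> + (1 / 16) ^ n"] ne by (auto simp: \<delta>_def)
  then obtain G where GF: "\<And>n. G n \<in> F" and G: "\<And>n. sq (G n) < \<delta> + (1 / 16) ^ n" by metis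
  have [measurable]: "G n \<in> borel_measurable M" for n using GF meas by blast
  have near: "expectation (\<lambda>x. (G n x - H x)\<^sup>2) \<le> (2 * (1 / 4) ^ n)\<^sup>2" if "H \<in> F" "sq H \<le> \<delta> + (1 / 16) ^ n" for n H
  proof -
    have "expectation (\<lambda>x. (G n x - H x)\<^sup>2) \<le> 4 * (1 / 16) ^ n"
      using parallelogram[OF GF[of n] that(1)] G[of n] that(2) by simp
    also have "\<dots> = (2 * (1 / 4) ^ n)\<^sup>2" by (simp add: power2_eq_square flip: power_mult_distrib)
    finally show ?thesis .
  qed
  \<comment> \<open>The competitors \<open>H n\<close> are left free because two choices are needed:
    \<open>G (Suc n)\<close> gives convergence, and \<open>G n\<close> composed with
    \<open>T v\<close>, which has the same second moment as \<open>G n\<close>, gives invariance of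
    the limit.\<close>
  have summ: "AE x in M. summable (\<lambda>n. G n x - H n x)"
    if H: "\<And>n. H n \<in> F" "\<And>n. sq (H n) \<le> \<delta> + (1 / 16) ^ n" for H
  proof (rule AE_summable_of_expectation_le[where b = "\<lambda>n. 2 * (1 / 4) ^ n"])
    show "integrable M (\<lambda>x. G n x - H n x)" for n
      by (intro Bochner_Integration.integrable_diff int1 GF H)
    show "expectation (\<lambda>x. (G n x - H n x)\<^sup>2) \<le> (2 * (1 / 4) ^ n)\<^sup>2" for n
      by (intro near H)
    show "integrable M (\<lambda>x. (G n x - H n x)\<^sup>2)" for n by (intro int2' GF H)
    show "summable (\<lambda>n. 2 * (1 / 4 :: real) ^ n)" by (intro summable_mult summable_geometric) simp
  qed simp
  have "AE x in M. summable (\<lambda>n. G n x - G (Suc n) x)"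
  proof (rule summ[OF GF])
    show "sq (G (Suc n)) \<le> \<delta> + (1 / 16) ^ n" for n
    proof -
      have "(1 / 16 :: real) ^ Suc n \<le> (1 / 16) ^ n" by (rule power_decreasing) simp_all
      with G[of "Suc n"] show ?thesis by linarith
    qed
  qed
  then have conv: "AE x in M. convergent (\<lambda>n. G n x)"
  proof eventually_elim
    case (elim x)
    then have "convergent (\<lambda>n. \<Sum>i<n. G i x - G (Suc i) x)" by (simp only: summable_iff_convergent)
    then have "convergent (\<lambda>n. G 0 x - G n x)" by (simp add: sum_lessThan_telescope'[of "\<lambda>i. G i x"])
    then have "convergent (\<lambda>n. G 0 x - (G 0 x - G n x))" by (rule convergent_diff[OF convergent_const])
    then show ?case by simp
  qed
  \<comment> \<open>Where the sequence diverges, \<open>lim\<close> has an unspecified value; by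
    \<open>conv\<close> this concerns only a null set.\<close>
  define L where "L x = lim (\<lambda>n. G n x)" for x
  have [measurable]: "L \<in> borel_measurable M" unfolding L_def by measurable
  have lim: "AE x in M. (\<lambda>n. G n x) \<longlonglongrightarrow> L x"
    using conv by eventually_elim (simp add: L_def convergent_LIMSEQ_iff)
  have "AE x in M. L (T v x) = L x" for v
  proof -
    have "sq (\<lambda>x. G n (T v x)) = sq (G n)" for n
      unfolding sq_def using integral_distr[OF T[of v], of "\<lambda>x. (G n x)\<^sup>2"] distr[of v] by simp
    then have "AE x in M. summable (\<lambda>n. G n x - G n (T v x))"
      using summ[of "\<lambda>n x. G n (T v x)", OF shift[OF GF]] G by (simp add: less_imp_le)
    moreover have "AE x in M. (\<lambda>n. G n (T v x)) \<longlonglongrightarrow> L (T v x)"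
      by (rule AE_distrD[OF T]) (unfold distr, rule lim)
    ultimately show ?thesis using lim
    proof eventually_elim
      case (elim x)
      have "(\<lambda>n. G n x - G n (T v x)) \<longlonglongrightarrow> L x - L (T v x)" using elim by (intro tendsto_diff)
      from LIMSEQ_unique[OF this summable_LIMSEQ_zero[OF elim(1)]] show ?case by simp
    qed
  qed
  note inv = this
  have G1: "AE x in M. norm (G n x) \<le> 1" for n using unit[OF GF[of n]] by (intro AE_I2) auto
  have int: "integrable M L"
    by (rule integrable_dominated_convergence[where s = G and w = "\<lambda>_. 1", OF _ _ _ lim G1]) simp_all
  have L: "AE x in M. L x = expectation L"
    by (rule AE_eq_expectation_if_invariant[OF T erg int inv])
  have "(\<lambda>n. expectation (G n)) \<longlonglongrightarrow> expectation L"
    by (rule integral_dominated_convergence[where w = "\<lambda>_. 1", OF _ _ _ lim G1]) simp_all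
  then have "expectation L = c" by (simp add: mean[OF GF] LIMSEQ_const_iff)
  with L have L: "AE x in M. L x = c" by simp
  have "(\<lambda>n. expectation (\<lambda>x. \<bar>G n x - c\<bar>)) \<longlonglongrightarrow> expectation (\<lambda>x. 0)"
  proof (rule integral_dominated_convergence[where w = "\<lambda>_. 1 + \<bar>c\<bar>"])
    show "AE x in M. (\<lambda>n. \<bar>G n x - c\<bar>) \<longlonglongrightarrow> 0"
      using lim L
    proof eventually_elim
      case (elim x)
      then have "(\<lambda>n. G n x - c) \<longlonglongrightarrow> 0" by (simp add: LIM_zero)
      then show ?case by (rule tendsto_rabs_zero)
    qed
    show "AE x in M. norm \<bar>G n x - c\<bar> \<le> 1 + \<bar>c\<bar>" for n
    proof (rule AE_I2)
      fix x assume "x \<in> space M"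
      then have "0 \<le> G n x" "G n x \<le> 1" using unit[OF GF] by auto
      then show "norm \<bar>G n x - c\<bar> \<le> 1 + \<bar>c\<bar>" by auto
    qed
  qed simp_all
  then have "eventually (\<lambda>n. expectation (\<lambda>x. \<bar>G n x - c\<bar>) < \<epsilon>) sequentially"
    by (rule order_tendstoD) (use \<open>0 < \<epsilon>\<close> in simp)
  then show ?thesis using GF by (auto simp: eventually_sequentially)
qed

section \<open>Pairings of dilated and translated functions\<close>

lemma SdD: "f \<in> Sd \<Longrightarrow> 0 \<le> f x" "f \<in> Sd \<Longrightarrow> f x \<le> 1" "f \<in> Sd \<Longrightarrow> f \<in> borel_measurable borel"
  by (auto simp: Sd_def)

lemma SdI: "f \<in> borel_measurable borel \<Longrightarrow> (\<And>x. 0 \<le> f x) \<Longrightarrow> (\<And>x. f x \<le> 1) \<Longrightarrow> f \<in> Sd"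
  by (simp add: Sd_def)

lemma dil_Sd [intro, simp]: assumes "f \<in> Sd" shows "dil t f \<in> Sd"
proof (rule SdI)
  note [measurable] = SdD(3)[OF assms]
  show "dil t f \<in> borel_measurable borel" unfolding dil_def by measurable
qed (simp_all add: dil_def SdD[OF assms])

lemma transl_Sd [intro, simp]: assumes "f \<in> Sd" shows "transl v f \<in> Sd"
proof (rule SdI)
  note [measurable] = SdD(3)[OF assms]
  show "transl v f \<in> borel_measurable borel" unfolding transl_def by measurable
qed (simp_all add: transl_def SdD[OF assms])

lemma one_Sd: "(\<lambda>_. 1) \<in> Sd"
  by (rule SdI) auto

lemma transl_transl: "transl v (transl w f) = transl (v + w) f"
  by (simp add: transl_def add_ac)

lemma dil_transl: "t \<noteq> 0 \<Longrightarrow> dil t (transl v f) = transl ((1 / t) *\<^sub>R v) (dil t f)"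
  by (simp add: transl_def dil_def fun_eq_iff algebra_simps)

lemma integrable_Sd_mult:
  assumes "f \<in> Sd" "integrable lborel g"
  shows "integrable lborel (\<lambda>x. f x * g x)"
proof (rule Bochner_Integration.integrable_bound[OF assms(2)])
  show "(\<lambda>x. f x * g x) \<in> borel_measurable lborel"
    using SdD(3)[OF assms(1)] assms(2) by (intro borel_measurable_times) auto
  show "AE x in lborel. norm (f x * g x) \<le> norm (g x)"
    by (rule AE_I2) (simp add: abs_mult mult_left_le_one_le SdD[OF assms(1)])
qed

lemma pair_L1_diff:
  assumes "f \<in> Sd" "integrable lborel g" "integrable lborel h"
  shows "pair_L1 f (\<lambda>x. g x - h x) = pair_L1 f g - pair_L1 f h"
  using integrable_Sd_mult[OF assms(1)] assms
  by (simp add: pair_L1_def right_diff_distrib)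

lemma abs_pair_L1_le:
  assumes "f \<in> Sd" "integrable lborel g"
  shows "\<bar>pair_L1 f g\<bar> \<le> (LINT x|lborel. \<bar>g x\<bar>)"
proof -
  have "\<bar>pair_L1 f g\<bar> \<le> (LINT x|lborel. \<bar>f x * g x\<bar>)"
    unfolding pair_L1_def using integral_norm_bound[of lborel "\<lambda>x. f x * g x"] by simp
  also have "\<dots> \<le> (LINT x|lborel. \<bar>g x\<bar>)"
    using integrable_Sd_mult[OF assms] assms
    by (intro integral_mono integrable_abs) (simp_all add: abs_mult mult_left_le_one_le SdD)
  finally show ?thesis .
qed

text \<open>Both entries of the pairing move with \<open>t\<close>, and \<open>h t\<close> need not
  converge. The bound by 1 on \<open>Sd\<close> makes L^1 convergence of the test functions
  sufficient.\<close>

lemma pair_L1_diff_tendsto_0: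
  assumes "\<And>t. h t \<in> Sd" and "eventually (\<lambda>t. integrable lborel (g t)) F" and "integrable lborel k"
    and "((\<lambda>t. LINT x|lborel. \<bar>g t x - k x\<bar>) \<longlongrightarrow> 0) F"
  shows "((\<lambda>t. pair_L1 (h t) (g t) - pair_L1 (h t) k) \<longlongrightarrow> 0) F"
proof (rule tendsto_rabs_zero_cancel, rule tendsto_sandwich[OF _ _ tendsto_const assms(4)])
  show "\<forall>\<^sub>F t in F. \<bar>pair_L1 (h t) (g t) - pair_L1 (h t) k\<bar> \<le> (LINT x|lborel. \<bar>g t x - k x\<bar>)"
    using assms(2)
  proof eventually_elim
    case (elim t)
    have "integrable lborel (\<lambda>x. g t x - k x)" using elim assms(3) by simp
    from abs_pair_L1_le[OF assms(1) this, of t] show ?case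
      by (simp add: pair_L1_diff[OF assms(1) elim assms(3)])
  qed
qed simp

section \<open>Change of variables in pairings\<close>

lemma lborel_eq_density_scaleR:
  "0 < t \<Longrightarrow> (lborel :: (real^'n) measure) =
    density (distr lborel borel (\<lambda>x. t *\<^sub>R x)) (\<lambda>_. ennreal (t ^ CARD('n)))"
  using lborel_affine[of t "0 :: real^'n"] by (simp add: ennreal_power)

lemma integral_lborel_scaleR:
  fixes h :: "real^'n \<Rightarrow> real"
  assumes [measurable]: "h \<in> borel_measurable borel" and "0 < t"
  shows "(LINT x|lborel. h x) = t ^ CARD('n) * (LINT x|lborel. h (t *\<^sub>R x))"
  by (subst lborel_eq_density_scaleR[OF assms(2)])
    (use assms(2) in \<open>simp add: integral_density integral_distr\<close>)

lemma integrable_lborel_scaleR: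
  fixes h :: "real^'n \<Rightarrow> real"
  assumes "integrable lborel h" and "0 < t"
  shows "integrable lborel (\<lambda>x. h (t *\<^sub>R x))"
proof -
  have [measurable]: "h \<in> borel_measurable borel" using assms by auto
  have "integrable (density (distr lborel borel (\<lambda>x. t *\<^sub>R x)) (\<lambda>_. ennreal (t ^ CARD('n)))) h"
    using assms(1) by (subst lborel_eq_density_scaleR[OF assms(2), symmetric])
  then show ?thesis
    using assms(2) by (simp add: integrable_density integrable_distr_eq)
qed

lemma pair_L1_dil_scaleR:
  fixes f :: "real^'n \<Rightarrow> real"
  assumes "f \<in> Sd" "integrable lborel g" "0 < t"
  shows "pair_L1 f g = t ^ CARD('n) * pair_L1 (dil t f) (\<lambda>x. g (t *\<^sub>R x))"
  unfolding pair_L1_def dil_def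
  by (rule integral_lborel_scaleR) (use SdD(3)[OF assms(1)] assms in auto)

lemma pair_L1_transl:
  fixes f :: "real^'n \<Rightarrow> real"
  assumes "f \<in> Sd" "integrable lborel g"
  shows "pair_L1 (transl v f) g = pair_L1 f (\<lambda>x. g (x - v))"
proof -
  note [measurable] = SdD(3)[OF assms(1)]
  have [measurable]: "g \<in> borel_measurable borel" using assms by auto
  have "pair_L1 f (\<lambda>x. g (x - v)) = (LINT x|distr lborel borel ((+) v). f x * g (x - v))"
    by (simp add: pair_L1_def lborel_distr_plus)
  also have "\<dots> = pair_L1 (transl v f) g"
    by (simp add: pair_L1_def integral_distr transl_def add_ac)
  finally show ?thesis by simp
qed

section \<open>Indicators of slightly deformed boxes\<close>

lemma integrable_indicator_box [simp]:
  "integrable lborel (indicator (box a b) :: 'a::euclidean_space \<Rightarrow> real)"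
  by (simp add: integrable_indicator_iff emeasure_lborel_box_finite[simplified])

lemma cbox_diff_box_null_sets: "cbox a b - box a b \<in> null_sets (lborel :: 'a::euclidean_space measure)"
  using negligible_frontier_interval[of a b]
  by (metis borel_open borel_closed closed_cbox open_box negligible_iff_null_sets
      null_sets_completion_iff sets.Diff sets_lborel)

text \<open>One statement serves three deformations: rounding to the lattice of mesh
  \<open>1 / t\<close>, a shift by \<open>v / t\<close>, and a dilation by a factor tending to 1.
  The growth condition keeps all deformed boxes inside one ball, whose indicator dominates.\<close>

lemma indicator_box_perturbation:
  fixes \<phi> :: "real \<Rightarrow> 'a::euclidean_space \<Rightarrow> 'a"
  assumes [measurable]: "\<And>t. \<phi> t \<in> borel_measurable borel"
    and lim: "\<And>x. ((\<lambda>t. \<phi> t x) \<longlongrightarrow> x) at_top"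
    and growth: "eventually (\<lambda>t. \<forall>x. norm x \<le> norm (\<phi> t x) + C) at_top"
  shows "eventually (\<lambda>t. integrable lborel (\<lambda>x. indicator (box a b) (\<phi> t x) :: real)) at_top"
    and "((\<lambda>t. LINT x|lborel. \<bar>indicator (box a b) (\<phi> t x) - indicator (box a b) x :: real\<bar>) \<longlongrightarrow> 0) at_top"
proof -
  let ?B = "box a b"
  obtain R where R: "\<And>x. x \<in> ?B \<Longrightarrow> norm x \<le> R" using bounded_box[of a b] by (auto simp: bounded_iff)
  \<comment> \<open>The absolute value puts \<open>box a b\<close> itself into \<open>K\<close>,
    whatever the sign of \<open>C\<close>.\<close>
  define K where "K = cball (0 :: 'a) (R + \<bar>C\<bar>)"
  have K: "integrable lborel (indicator K :: 'a \<Rightarrow> real)"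
    unfolding K_def by (simp add: integrable_indicator_iff emeasure_lborel_cball_finite[simplified])
  have dom: "eventually (\<lambda>t. \<forall>x. \<phi> t x \<in> ?B \<longrightarrow> x \<in> K) at_top"
    using growth
  proof eventually_elim
    case (elim t)
    show ?case
    proof (intro allI impI)
      fix x assume "\<phi> t x \<in> ?B"
      then have "norm x \<le> R + C" using R elim[rule_format, of x] by fastforce
      then show "x \<in> K" by (simp add: K_def)
    qed
  qed
  show "eventually (\<lambda>t. integrable lborel (\<lambda>x. indicator ?B (\<phi> t x) :: real)) at_top"
    using dom
  proof eventually_elim
    case (elim t)
    show ?case
      by (rule Bochner_Integration.integrable_bound[OF K])
         (use elim in \<open>auto intro!: AE_I2 split: split_indicator\<close>)
  qed
  have BK: "?B \<subseteq> K" using R by (fastforce simp: K_def)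
  have "((\<lambda>t. LINT x|lborel. \<bar>indicator ?B (\<phi> t x) - indicator ?B x :: real\<bar>) \<longlongrightarrow> (LINT x|(lborel :: 'a measure). 0)) at_top"
  proof (rule integral_dominated_convergence_at_top[where w = "indicator K"])
    show "\<forall>\<^sub>F t in at_top. AE x in lborel. norm \<bar>indicator ?B (\<phi> t x) - indicator ?B x :: real\<bar> \<le> indicator K x"
      using dom by eventually_elim (use BK in \<open>auto intro!: AE_I2 split: split_indicator\<close>)
    show "AE x in lborel. ((\<lambda>t. \<bar>indicator ?B (\<phi> t x) - indicator ?B x :: real\<bar>) \<longlongrightarrow> 0) at_top"
      using AE_not_in[OF cbox_diff_box_null_sets[of a b]]
    proof eventually_elim
      case (elim x)
      \<comment> \<open>Off the null boundary, \<open>x\<close> lies in one of two open sets, and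
        \<open>\<phi> t x\<close> eventually lies in the same one, so the indicator stops
        changing.\<close>
      then consider "x \<in> ?B" | "x \<in> - cbox a b" by auto
      then have "\<forall>\<^sub>F t in at_top. indicator ?B (\<phi> t x) = (indicator ?B x :: real)"
      proof cases
        case 1
        then have "\<forall>\<^sub>F t in at_top. \<phi> t x \<in> ?B" using lim[of x] topological_tendstoD open_box by blast
        then show ?thesis by eventually_elim (use 1 in simp)
      next
        case 2
        then have "\<forall>\<^sub>F t in at_top. \<phi> t x \<in> - cbox a b"
          using lim[of x] topological_tendstoD open_Compl closed_cbox by blast
        then show ?thesis
          by eventually_elim (use 2 box_subset_cbox[of a b] in \<open>auto simp: indicator_def\<close>)
      qed
      then show ?case by (intro tendsto_eventually) (auto elim: eventually_mono)
    qed
  qed (use K in simp_all)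
  then show "((\<lambda>t. LINT x|lborel. \<bar>indicator ?B (\<phi> t x) - indicator ?B x :: real\<bar>) \<longlongrightarrow> 0) at_top"
    by simp
qed

lemma pair_L1_box_perturbation:
  fixes \<phi> :: "real \<Rightarrow> real^'n \<Rightarrow> real^'n"
  assumes "\<And>t. \<phi> t \<in> borel_measurable borel"
    and "\<And>x. ((\<lambda>t. \<phi> t x) \<longlongrightarrow> x) at_top"
    and "eventually (\<lambda>t. \<forall>x. norm x \<le> norm (\<phi> t x) + C) at_top"
    and "\<And>t. h t \<in> Sd"
  shows "((\<lambda>t. pair_L1 (h t) (\<lambda>x. indicator (box a b) (\<phi> t x)) - pair_L1 (h t) (indicator (box a b)))
    \<longlongrightarrow> 0) at_top"
  by (intro pair_L1_diff_tendsto_0 indicator_box_perturbation[OF assms(1-3)] assms(4) integrable_indicator_box)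

section \<open>Lattice averages\<close>

definition ivec :: "('n \<Rightarrow> int) \<Rightarrow> real^'n" where
  "ivec k = (\<chi> i. real_of_int (k i))"

definition vfloor :: "real^'n \<Rightarrow> ('n \<Rightarrow> int)" where
  "vfloor x = (\<lambda>i. \<lfloor>x $ i\<rfloor>)"

text \<open>Half open, so that the integer translates partition the space exactly; the closed cube
  of the theorem differs from it by a null set.\<close>

definition unit_cell :: "(real^'n) set" where
  "unit_cell = {x. \<forall>i. 0 \<le> x $ i \<and> x $ i < 1}"

definition cell_mean :: "(real^'n \<Rightarrow> real) \<Rightarrow> real" where
  "cell_mean f = pair_L1 f (indicator unit_cell)"

definition lattice_box :: "real \<Rightarrow> real^'n \<Rightarrow> real^'n \<Rightarrow> ('n \<Rightarrow> int) set" where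
  "lattice_box t a b = {k. (1 / t) *\<^sub>R ivec k \<in> box a b}"

text \<open>The divisor is a power of \<open>t\<close> and not the number of lattice points, to
  match the pairing of \<open>dil t f\<close> with the indicator of the box: that is the integral of
  \<open>f\<close> over the box scaled by \<open>t\<close>, divided by the same power. Empty boxes
  then need no exception.\<close>

definition lattice_mean :: "real \<Rightarrow> real^'n \<Rightarrow> real^'n \<Rightarrow> ((real^'n \<Rightarrow> real) \<Rightarrow> real) \<Rightarrow> (real^'n \<Rightarrow> real) \<Rightarrow> real" where
  "lattice_mean t a b G f = (\<Sum>k\<in>lattice_box t a b. G (transl (ivec k) f)) / t ^ CARD('n)"

lemma ivec_add: "ivec (\<lambda>i. j i + k i) = ivec j + ivec k"
  by (simp add: ivec_def vec_eq_iff)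

lemma mem_unit_cell_diff_ivec: "x - ivec k \<in> unit_cell \<longleftrightarrow> vfloor x = k"
  unfolding unit_cell_def vfloor_def ivec_def fun_eq_iff
  by (auto simp: floor_eq_iff algebra_simps)

lemma ivec_vfloor_measurable [measurable]:
  "(\<lambda>x :: real^'n. ivec (vfloor x)) \<in> borel_measurable borel"
proof (subst borel_measurable_euclidean_space, rule ballI)
  fix e :: "real^'n" assume "e \<in> Basis"
  then obtain i where "e = axis i 1" by (auto simp: Basis_vec_def)
  then have "(\<lambda>x :: real^'n. ivec (vfloor x) \<bullet> e) = (\<lambda>x. real_of_int \<lfloor>x \<bullet> e\<rfloor>)"
    by (simp add: ivec_def vfloor_def inner_axis)
  then show "(\<lambda>x :: real^'n. ivec (vfloor x) \<bullet> e) \<in> borel_measurable borel" by simp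
qed

text \<open>In this form measurability of the cell is inherited from the rounding map
  \<open>ivec (vfloor x)\<close>.\<close>

lemma unit_cell_eq: "(indicator unit_cell :: real^'n \<Rightarrow> real) = (\<lambda>x. indicator {0} (ivec (vfloor x)))"
proof
  fix x :: "real^'n"
  have "x \<in> unit_cell \<longleftrightarrow> vfloor x = (\<lambda>_. 0)"
    using mem_unit_cell_diff_ivec[of x "\<lambda>_. 0"] by (simp add: ivec_def flip: zero_vec_def)
  also have "\<dots> \<longleftrightarrow> ivec (vfloor x) = 0"
    by (simp add: ivec_def vec_eq_iff fun_eq_iff)
  finally show "(indicator unit_cell x :: real) = indicator {0} (ivec (vfloor x))"
    by (simp add: indicator_def)
qed

lemma unit_cell_AE_eq: "AE x in lborel. (indicator (unit_cell :: (real^'n) set) x :: real) = indicator (cbox 0 One) x"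
proof -
  have cbox: "x \<in> cbox 0 One \<longleftrightarrow> (\<forall>i. 0 \<le> x $ i \<and> x $ i \<le> 1)"
    and box: "x \<in> box 0 One \<longleftrightarrow> (\<forall>i. 0 < x $ i \<and> x $ i < 1)" for x :: "real^'n"
  proof -
    have "(\<forall>e\<in>Basis. P (x \<bullet> e)) \<longleftrightarrow> (\<forall>i. P (x $ i))" for P
      by (auto simp: Basis_vec_def inner_axis)
    from this[of "\<lambda>y. 0 \<le> y \<and> y \<le> 1"] this[of "\<lambda>y. 0 < y \<and> y < 1"]
    show "x \<in> cbox 0 One \<longleftrightarrow> (\<forall>i. 0 \<le> x $ i \<and> x $ i \<le> 1)"
      and "x \<in> box 0 One \<longleftrightarrow> (\<forall>i. 0 < x $ i \<and> x $ i < 1)"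
      by (simp_all add: mem_box)
  qed
  show ?thesis
    using AE_not_in[OF cbox_diff_box_null_sets[of 0 "One :: real^'n"]]
  proof eventually_elim
    case (elim x)
    then have "x \<in> unit_cell \<longleftrightarrow> x \<in> cbox 0 One"
      unfolding Diff_iff cbox box by (auto simp: unit_cell_def less_imp_le)
    then show ?case by (simp add: indicator_def)
  qed
qed

lemma integrable_unit_cell: "integrable lborel (indicator (unit_cell :: (real^'n) set) :: _ \<Rightarrow> real)"
proof -
  have "integrable lborel (indicator (cbox 0 One) :: real^'n \<Rightarrow> real)"
    by (simp add: integrable_indicator_iff emeasure_lborel_cbox_finite[simplified])
  moreover have "(indicator unit_cell :: real^'n \<Rightarrow> real) \<in> borel_measurable lborel"
    unfolding unit_cell_eq by measurable
  ultimately show ?thesis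
    by (subst integrable_cong_AE[OF _ _ unit_cell_AE_eq]) auto
qed

lemma cell_mean_eq: "f \<in> Sd \<Longrightarrow> cell_mean f = (LINT x:cbox 0 One|lborel. f x)"
  unfolding cell_mean_def pair_L1_def set_lebesgue_integral_def
proof (rule integral_cong_AE)
  assume f: "f \<in> Sd"
  note [measurable] = SdD(3)[OF f]
  show "(\<lambda>x. f x * indicator unit_cell x) \<in> borel_measurable lborel"
    unfolding unit_cell_eq by measurable
  show "(\<lambda>x. indicat_real (cbox 0 One) x *\<^sub>R f x) \<in> borel_measurable lborel" by measurable
  show "AE x in lborel. f x * indicator unit_cell x = indicat_real (cbox 0 One) x *\<^sub>R f x"
    using unit_cell_AE_eq by eventually_elim simp
qed

lemma cell_mean_one: "cell_mean (\<lambda>_ :: real^'n. 1) = 1"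
proof -
  have "(LINT x|lborel. indicator (unit_cell :: (real^'n) set) x :: real) = (LINT x|lborel. indicator (cbox 0 (One :: real^'n)) x)"
    using integrable_unit_cell by (intro integral_cong_AE unit_cell_AE_eq) auto
  then show ?thesis
    by (simp add: cell_mean_def pair_L1_def)
qed

lemma lattice_box_subset:
  assumes "\<And>x. x \<in> box a b \<Longrightarrow> norm x \<le> R" "0 < t"
  shows "lattice_box t a b \<subseteq> icube (\<lambda>_. 0) (nat \<lceil>t * R\<rceil>)"
proof
  fix k assume "k \<in> lattice_box t a b"
  then have "norm ((1 / t) *\<^sub>R ivec k) \<le> R" using assms(1) unfolding lattice_box_def by blast
  then have "norm (ivec k) \<le> t * R" using assms(2) by (simp add: pos_divide_le_eq mult.commute)
  then have "\<bar>real_of_int (k i)\<bar> \<le> t * R" for i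
    using component_le_norm_cart[of "ivec k" i] by (simp add: ivec_def)
  then have "real_of_int \<bar>k i\<bar> \<le> real_of_int \<lceil>t * R\<rceil>" for i
    using le_of_int_ceiling[of "t * R"] order_trans by (metis of_int_abs)
  then have "\<bar>k i\<bar> \<le> \<lceil>t * R\<rceil>" for i by (simp only: of_int_le_iff)
  then have "\<bar>k i\<bar> \<le> int (nat \<lceil>t * R\<rceil>)" for i by (rule order_trans) simp
  then show "k \<in> icube (\<lambda>_. 0) (nat \<lceil>t * R\<rceil>)" by (simp add: icube_def)
qed

lemma finite_lattice_box:
  assumes "0 < t" shows "finite (lattice_box t a b)"
proof -
  obtain R where "\<And>x. x \<in> box a b \<Longrightarrow> norm x \<le> R" using bounded_box[of a b] by (auto simp: bounded_iff)
  from finite_subset[OF lattice_box_subset[OF this assms]] show ?thesis by simp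
qed

text \<open>Translated cells tile, so summing cell averages integrates \<open>f\<close> over a union
  of cells. A point counts when the corner of its cell, rather than the point itself, lies in the
  scaled box; rounding is the only discrepancy.\<close>

lemma lattice_mean_cell_mean:
  fixes f :: "real^'n \<Rightarrow> real"
  assumes f: "f \<in> Sd" and t: "0 < t"
  shows "lattice_mean t a b cell_mean f
    = pair_L1 (dil t f) (\<lambda>x. indicator (box a b) ((1 / t) *\<^sub>R ivec (vfloor (t *\<^sub>R x))))"
proof -
  note fin = finite_lattice_box[OF t, of a b]
  have int: "integrable lborel (\<lambda>x :: real^'n. indicator unit_cell (x - ivec k) :: real)" for k
  proof -
    have "integrable (distr lborel borel ((+) (- ivec k))) (indicator (unit_cell :: (real^'n) set) :: _ \<Rightarrow> real)"
      by (simp add: lborel_distr_plus integrable_unit_cell)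
    then have "integrable lborel (\<lambda>x :: real^'n. indicator unit_cell (- ivec k + x) :: real)"
      by (rule integrable_distr[rotated]) simp
    then show ?thesis by (simp add: add.commute)
  qed
  \<comment> \<open>Each \<open>x\<close> lies in exactly one cell, so at most one term survives:
    the one with \<open>k = vfloor x\<close>.\<close>
  have sum: "(\<Sum>k\<in>lattice_box t a b. indicator unit_cell (x - ivec k))
      = (indicator (box a b) ((1 / t) *\<^sub>R ivec (vfloor x)) :: real)" for x :: "real^'n"
    using fin by (simp add: indicator_def mem_unit_cell_diff_ivec lattice_box_def sum.delta)
  have "(\<Sum>k\<in>lattice_box t a b. cell_mean (transl (ivec k) f))
      = (\<Sum>k\<in>lattice_box t a b. pair_L1 f (\<lambda>x. indicator unit_cell (x - ivec k)))"
    by (simp add: cell_mean_def pair_L1_transl[OF f integrable_unit_cell])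
  also have "\<dots> = pair_L1 f (\<lambda>x. \<Sum>k\<in>lattice_box t a b. indicator unit_cell (x - ivec k))"
    unfolding pair_L1_def sum_distrib_left
    by (rule Bochner_Integration.integral_sum[symmetric]) (rule integrable_Sd_mult[OF f int])
  also have "\<dots> = t ^ CARD('n) * pair_L1 (dil t f) (\<lambda>x. \<Sum>k\<in>lattice_box t a b. indicator unit_cell (t *\<^sub>R x - ivec k))"
    by (rule pair_L1_dil_scaleR[OF f _ t]) (intro Bochner_Integration.integrable_sum int)
  finally show ?thesis
    using t by (simp add: lattice_mean_def sum)
qed

text \<open>The property is what survives of being a convex combination of translates of
  \<open>cell_mean\<close>: it is closed under translation and midpoints, the closure that
  \<open>mean_ergodic_midpoint_family\<close> asks for.\<close>

definition box_averaging :: "((real^'n \<Rightarrow> real) \<Rightarrow> real) \<Rightarrow> bool" where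
  "box_averaging G \<longleftrightarrow> (\<forall>f\<in>Sd. \<forall>a b.
    ((\<lambda>t. lattice_mean t a b G f - pair_L1 (dil t f) (indicator (box a b))) \<longlongrightarrow> 0) at_top)"

lemma box_averaging_cell_mean: "box_averaging (cell_mean :: (real^'n \<Rightarrow> real) \<Rightarrow> real)"
  unfolding box_averaging_def
proof (intro ballI allI)
  fix f :: "real^'n \<Rightarrow> real" and a b :: "real^'n"
  assume f: "f \<in> Sd"
  define \<phi> where "\<phi> t x = (1 / t) *\<^sub>R ivec (vfloor (t *\<^sub>R x))" for t :: real and x :: "real^'n"
  \<comment> \<open>Rounding moves each coordinate of \<open>x\<close> by a fractional part divided
    by \<open>t\<close>; the l^1 norm sums these bounds over the coordinates.\<close>
  have close: "norm (\<phi> t x - x) \<le> CARD('n) / t" if "0 < t" for t x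
  proof -
    have "\<bar>(\<phi> t x - x) $ i\<bar> \<le> 1 / t" for i
    proof -
      have "(\<phi> t x - x) $ i = - frac (t * x $ i) / t"
        using that by (simp add: \<phi>_def ivec_def vfloor_def frac_def field_simps)
      then show ?thesis
        using that frac_ge_0[of "t * x $ i"] frac_lt_1[of "t * x $ i"]
        by (simp add: divide_right_mono less_imp_le)
    qed
    then have "(\<Sum>i\<in>UNIV. \<bar>(\<phi> t x - x) $ i\<bar>) \<le> (\<Sum>i\<in>(UNIV :: 'n set). 1 / t)" by (intro sum_mono)
    with norm_le_l1_cart[of "\<phi> t x - x"] show ?thesis by simp
  qed
  have "((\<lambda>t. pair_L1 (dil t f) (\<lambda>x. indicator (box a b) (\<phi> t x)) - pair_L1 (dil t f) (indicator (box a b)))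
    \<longlongrightarrow> 0) at_top"
  proof (rule pair_L1_box_perturbation[where C = "CARD('n)"])
    show "\<phi> t \<in> borel_measurable borel" for t unfolding \<phi>_def by measurable
    show "((\<lambda>t. \<phi> t x) \<longlongrightarrow> x) at_top" for x
    proof (rule LIM_zero_cancel, rule Lim_null_comparison)
      show "\<forall>\<^sub>F t in at_top. norm (\<phi> t x - x) \<le> CARD('n) / t"
        using eventually_gt_at_top[of 0] by eventually_elim (rule close)
      show "((\<lambda>t :: real. CARD('n) / t) \<longlongrightarrow> 0) at_top"
        by (rule tendsto_divide_0[OF tendsto_const]) (rule filterlim_at_top_imp_at_infinity[OF filterlim_ident])
    qed
    show "\<forall>\<^sub>F t in at_top. \<forall>x. norm x \<le> norm (\<phi> t x) + CARD('n)"
      using eventually_ge_at_top[of 1]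
    proof eventually_elim
      case (elim t)
      show ?case
      proof
        fix x
        have "CARD('n) / t \<le> CARD('n)" using elim by (simp add: field_simps)
        with close[of t x] elim have "norm (\<phi> t x - x) \<le> CARD('n)" by simp
        then show "norm x \<le> norm (\<phi> t x) + CARD('n)"
          using norm_triangle_ineq2[of x "\<phi> t x"] by (simp add: norm_minus_commute)
      qed
    qed
  qed (use f in simp)
  moreover have "\<forall>\<^sub>F t in at_top. lattice_mean t a b cell_mean f = pair_L1 (dil t f) (\<lambda>x. indicator (box a b) (\<phi> t x))"
    using eventually_gt_at_top[of 0] by eventually_elim (simp add: lattice_mean_cell_mean[OF f] \<phi>_def)
  then have "\<forall>\<^sub>F t in at_top. pair_L1 (dil t f) (\<lambda>x. indicator (box a b) (\<phi> t x)) - pair_L1 (dil t f) (indicator (box a b))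
      = lattice_mean t a b cell_mean f - pair_L1 (dil t f) (indicator (box a b))"
    by eventually_elim simp
  ultimately show "((\<lambda>t. lattice_mean t a b cell_mean f - pair_L1 (dil t f) (indicator (box a b))) \<longlongrightarrow> 0) at_top"
    by (rule Lim_transform_eventually)
qed

text \<open>The hypothesis is applied to \<open>transl v f\<close>. Dilation by \<open>t\<close>
  shrinks the shift \<open>v\<close> to \<open>v / t\<close>, which leaves only a vanishing shift of
  the box to absorb.\<close>

lemma box_averaging_transl:
  fixes G :: "(real^'n \<Rightarrow> real) \<Rightarrow> real"
  assumes "box_averaging G"
  shows "box_averaging (\<lambda>f. G (transl v f))"
  unfolding box_averaging_def
proof (intro ballI allI)
  fix f :: "real^'n \<Rightarrow> real" and a b :: "real^'n"
  assume f: "f \<in> Sd"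
  let ?B = "box a b"
  have inv: "((\<lambda>t :: real. (1 / t) *\<^sub>R v) \<longlongrightarrow> 0) at_top"
    using tendsto_scaleR[OF tendsto_divide_0[OF tendsto_const filterlim_at_top_imp_at_infinity[OF filterlim_ident]] tendsto_const, of 1 v]
    by simp
  have "((\<lambda>t. pair_L1 (dil t f) (\<lambda>x. indicator ?B (x - (1 / t) *\<^sub>R v)) - pair_L1 (dil t f) (indicator ?B))
    \<longlongrightarrow> 0) at_top"
  proof (rule pair_L1_box_perturbation[where C = 1])
    show "((\<lambda>t. x - (1 / t) *\<^sub>R v) \<longlongrightarrow> x) at_top" for x
      using tendsto_diff[OF tendsto_const inv] by simp
    have "\<forall>\<^sub>F t in at_top. norm ((1 / t) *\<^sub>R v) < 1"
      using tendstoD[OF inv, of 1] by (simp add: dist_norm)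
    then show "\<forall>\<^sub>F t in at_top. \<forall>x. norm x \<le> norm (x - (1 / t) *\<^sub>R v) + 1"
    proof eventually_elim
      case (elim t)
      show ?case
      proof
        fix x show "norm x \<le> norm (x - (1 / t) *\<^sub>R v) + 1"
          using norm_triangle_sub[of x "(1 / t) *\<^sub>R v"] elim by linarith
      qed
    qed
  qed (use f in simp_all)
  moreover have "((\<lambda>t. lattice_mean t a b G (transl v f) - pair_L1 (dil t (transl v f)) (indicator ?B)) \<longlongrightarrow> 0) at_top"
    using assms f by (simp add: box_averaging_def)
  ultimately have "((\<lambda>t. (lattice_mean t a b G (transl v f) - pair_L1 (dil t (transl v f)) (indicator ?B)) +
     (pair_L1 (dil t f) (\<lambda>x. indicator ?B (x - (1 / t) *\<^sub>R v)) - pair_L1 (dil t f) (indicator ?B))) \<longlongrightarrow> 0) at_top"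
    by (intro tendsto_add_zero)
  moreover have "\<forall>\<^sub>F t in at_top. (lattice_mean t a b G (transl v f) - pair_L1 (dil t (transl v f)) (indicator ?B)) +
     (pair_L1 (dil t f) (\<lambda>x. indicator ?B (x - (1 / t) *\<^sub>R v)) - pair_L1 (dil t f) (indicator ?B))
     = lattice_mean t a b (\<lambda>f. G (transl v f)) f - pair_L1 (dil t f) (indicator ?B)"
    using eventually_gt_at_top[of 0]
  proof eventually_elim
    case (elim t)
    have "pair_L1 (dil t (transl v f)) (indicator ?B) = pair_L1 (dil t f) (\<lambda>x. indicator ?B (x - (1 / t) *\<^sub>R v))"
      using elim f by (simp add: dil_transl pair_L1_transl del: scaleR_cancel_left)
    then show ?case by (simp add: lattice_mean_def transl_transl add.commute)
  qed
  ultimately show "((\<lambda>t. lattice_mean t a b (\<lambda>f. G (transl v f)) f - pair_L1 (dil t f) (indicator ?B)) \<longlongrightarrow> 0) at_top"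
    by (rule Lim_transform_eventually)
qed

lemma box_averaging_midpoint:
  fixes G H :: "(real^'n \<Rightarrow> real) \<Rightarrow> real"
  assumes "box_averaging G" "box_averaging H"
  shows "box_averaging (\<lambda>f. (G f + H f) / 2)"
  unfolding box_averaging_def
proof (intro ballI allI)
  fix f :: "real^'n \<Rightarrow> real" and a b :: "real^'n"
  assume f: "f \<in> Sd"
  have "lattice_mean t a b (\<lambda>f. (G f + H f) / 2) f = (lattice_mean t a b G f + lattice_mean t a b H f) / 2" for t
    by (simp add: lattice_mean_def sum.distrib add_divide_distrib flip: sum_divide_distrib)
  then have *: "lattice_mean t a b (\<lambda>f. (G f + H f) / 2) f - pair_L1 (dil t f) (indicator (box a b))
    = ((lattice_mean t a b G f - pair_L1 (dil t f) (indicator (box a b)))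
      + (lattice_mean t a b H f - pair_L1 (dil t f) (indicator (box a b)))) / 2" for t
    by (simp add: field_simps)
  show "((\<lambda>t. lattice_mean t a b (\<lambda>f. (G f + H f) / 2) f - pair_L1 (dil t f) (indicator (box a b))) \<longlongrightarrow> 0) at_top"
    unfolding * using assms f unfolding box_averaging_def
    by (intro tendsto_divide_zero tendsto_add_zero) auto
qed

text \<open>The count is the lattice mean of the unit cell average of the constant function 1.\<close>
lemma lattice_count_tendsto:
  fixes a b :: "real^'n"
  shows "((\<lambda>t. card (lattice_box t a b) / t ^ CARD('n)) \<longlongrightarrow> measure lborel (box a b)) at_top"
proof -
  have "lattice_mean t a b cell_mean (\<lambda>_. 1) = card (lattice_box t a b) / t ^ CARD('n)" for t
    by (simp add: lattice_mean_def transl_def cell_mean_one)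
  moreover have "pair_L1 (dil t (\<lambda>_. 1)) (indicator (box a b)) = measure lborel (box a b)" for t
    by (simp add: pair_L1_def dil_def)
  ultimately have "((\<lambda>t. card (lattice_box t a b) / t ^ CARD('n) - measure lborel (box a b)) \<longlongrightarrow> 0) at_top"
    using box_averaging_cell_mean[unfolded box_averaging_def, rule_format, OF one_Sd, of a b] by simp
  then show ?thesis by (rule LIM_zero_cancel)
qed

section \<open>Reduction to rational boxes\<close>

definition rational_vec :: "real^'n \<Rightarrow> bool" where
  "rational_vec a \<longleftrightarrow> (\<forall>i. a $ i \<in> \<rat>)"

lemma countable_rational_vec: "countable {a :: real^'n. rational_vec a}"
proof (rule countable_subset)
  show "{a :: real^'n. rational_vec a} \<subseteq> range (\<lambda>q :: 'n \<Rightarrow> rat. \<chi> i. of_rat (q i))"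
  proof
    fix a :: "real^'n" assume "a \<in> {a. rational_vec a}"
    then have "\<forall>i. \<exists>q. a $ i = of_rat q" by (auto simp: rational_vec_def Rats_def)
    then obtain q where "\<And>i. a $ i = of_rat (q i)" by metis
    then have "a = (\<chi> i. of_rat (q i))" by (simp add: vec_eq_iff)
    then show "a \<in> range (\<lambda>q :: 'n \<Rightarrow> rat. \<chi> i. of_rat (q i))" by blast
  qed
qed simp

definition rational_boxes :: "(real^'n) set set" where
  "rational_boxes = {box a b | a b. rational_vec a \<and> rational_vec b}"

lemma countable_rational_boxes: "countable (rational_boxes :: (real^'n) set set)"
proof -
  have eq: "(rational_boxes :: (real^'n) set set) = (\<lambda>(a, b). box a b) ` ({a. rational_vec a} \<times> {b. rational_vec b})"
    by (auto simp: rational_boxes_def)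
  show ?thesis unfolding eq by (intro countable_image countable_SIGMA countable_rational_vec)
qed

lemma borel_eq_sigma_rational_boxes: "(borel :: (real^'n) measure) = sigma UNIV rational_boxes"
proof (rule borel_eq_countable_basis[OF countable_rational_boxes])
  show "topological_basis (rational_boxes :: (real^'n) set set)"
  proof (rule topological_basisI)
    fix S and x :: "real^'n" assume "open S" "x \<in> S"
    then obtain e where e: "0 < e" "ball x e \<subseteq> S" by (auto simp: open_contains_ball)
    obtain a b where ab: "\<forall>i\<in>Basis. a \<bullet> i \<in> \<rat> \<and> b \<bullet> i \<in> \<rat>" "x \<in> box a b" "box a b \<subseteq> ball x e"
      using rational_boxes[OF e(1), of x] by blast
    have "axis i 1 \<in> (Basis :: (real^'n) set)" for i by (simp add: axis_in_Basis_iff)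
    then have "rational_vec a" "rational_vec b"
      using ab(1) unfolding rational_vec_def by (metis cart_eq_inner_axis)+
    then show "\<exists>B\<in>rational_boxes. x \<in> B \<and> B \<subseteq> S"
      using ab e unfolding rational_boxes_def by blast
  qed (auto simp: rational_boxes_def)
qed

lemma Int_stable_rational_boxes: "Int_stable (rational_boxes :: (real^'n) set set)"
proof (rule Int_stableI)
  fix A B :: "(real^'n) set" assume "A \<in> rational_boxes" "B \<in> rational_boxes"
  then obtain a b a' b' where *: "A = box a b" "B = box a' b'"
    "rational_vec a" "rational_vec b" "rational_vec a'" "rational_vec b'"
    by (auto simp: rational_boxes_def)
  have "A \<inter> B = box (\<chi> i. max (a $ i) (a' $ i)) (\<chi> i. min (b $ i) (b' $ i))"
    unfolding * by (auto simp: mem_box_cart)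
  moreover have "rational_vec (\<chi> i. max (a $ i) (a' $ i))" "rational_vec (\<chi> i. min (b $ i) (b' $ i))"
    using * by (simp_all add: rational_vec_def max_def min_def)
  ultimately show "A \<inter> B \<in> rational_boxes" unfolding rational_boxes_def by blast
qed

section \<open>From box indicators to all of L^1\<close>

lemma pair_L1_tendsto_of_L1_approx:
  assumes h: "\<And>t. h t \<in> Sd" "h0 \<in> Sd"
    and int: "\<And>j. integrable lborel (s j)" "integrable lborel g"
    and lim: "(\<lambda>j. LINT x|lborel. \<bar>s j x - g x\<bar>) \<longlonglongrightarrow> 0"
    and conv: "\<And>j. ((\<lambda>t. pair_L1 (h t) (s j)) \<longlongrightarrow> pair_L1 h0 (s j)) F"
  shows "((\<lambda>t. pair_L1 (h t) g) \<longlongrightarrow> pair_L1 h0 g) F"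
proof (rule tendstoI)
  fix e :: real assume "0 < e"
  then have "eventually (\<lambda>j. (LINT x|lborel. \<bar>s j x - g x\<bar>) < e / 3) sequentially"
    using lim by (intro order_tendstoD) auto
  then obtain j where j: "(LINT x|lborel. \<bar>s j x - g x\<bar>) < e / 3"
    by (auto simp: eventually_sequentially)
  have near: "\<bar>pair_L1 k (s j) - pair_L1 k g\<bar> < e / 3" if "k \<in> Sd" for k
    using abs_pair_L1_le[OF that, of "\<lambda>x. s j x - g x"] j int pair_L1_diff[OF that int(1)[of j] int(2)] by simp
  have "\<forall>\<^sub>F t in F. dist (pair_L1 (h t) (s j)) (pair_L1 h0 (s j)) < e / 3"
    using conv[of j] \<open>0 < e\<close> by (intro tendstoD) auto
  then show "\<forall>\<^sub>F t in F. dist (pair_L1 (h t) g) (pair_L1 h0 g) < e"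
  proof eventually_elim
    case (elim t)
    then show ?case using near[OF h(1)[of t]] near[OF h(2)] unfolding dist_real_def by linarith
  qed
qed

text \<open>A form of the L^1 approximation fit for the limit steps below: increasing unions of
  sets, exhaustion by bounded windows, and the limit case of
  \<open>integrable_induct\<close>.\<close>

lemma pair_L1_tendsto_dominated:
  fixes g :: "real^'n \<Rightarrow> real"
  assumes h: "\<And>t. h t \<in> Sd" "h0 \<in> Sd"
    and [measurable]: "\<And>j. s j \<in> borel_measurable lborel" "g \<in> borel_measurable lborel"
    and w: "integrable lborel w"
    and lim: "\<And>x. (\<lambda>j. s j x) \<longlonglongrightarrow> g x" and dom: "\<And>j x. \<bar>s j x\<bar> \<le> w x"
    and conv: "\<And>j. ((\<lambda>t. pair_L1 (h t) (s j)) \<longlongrightarrow> pair_L1 h0 (s j)) F"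
  shows "((\<lambda>t. pair_L1 (h t) g) \<longlongrightarrow> pair_L1 h0 g) F"
proof (rule pair_L1_tendsto_of_L1_approx[OF h _ _ _ conv])
  have domg: "\<bar>g x\<bar> \<le> w x" for x
    by (rule LIMSEQ_le_const2[OF tendsto_rabs[OF lim]]) (use dom in blast)
  have wn: "w x = \<bar>w x\<bar>" for x using domg[of x] by simp
  show "integrable lborel (s j)" for j
    by (rule Bochner_Integration.integrable_bound[OF w]) (use dom wn in auto)
  show "integrable lborel g"
    by (rule Bochner_Integration.integrable_bound[OF w]) (use domg wn in auto)
  have "(\<lambda>j. LINT x|lborel. \<bar>s j x - g x\<bar>) \<longlonglongrightarrow> (LINT x|(lborel :: (real^'n) measure). 0)"
  proof (rule integral_dominated_convergence[where w = "\<lambda>x. 2 * w x"])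
    show "AE x in lborel. (\<lambda>j. \<bar>s j x - g x\<bar>) \<longlonglongrightarrow> 0"
      using lim by (intro AE_I2 tendsto_rabs_zero LIM_zero)
    show "AE x in lborel. norm \<bar>s j x - g x\<bar> \<le> 2 * w x" for j
    proof (rule AE_I2)
      fix x show "norm \<bar>s j x - g x\<bar> \<le> 2 * w x" using dom[of j x] domg[of x] by simp
    qed
  qed (use w in simp_all)
  then show "(\<lambda>j. LINT x|lborel. \<bar>s j x - g x\<bar>) \<longlonglongrightarrow> 0" by simp
qed

text \<open>Rational boxes are closed under intersection and generate the Borel sets, so Dynkin
  induction reaches all Borel sets inside a bounded window. Exhaustion gives sets of finite measure,
  and \<open>integrable_induct\<close> the integrable functions.\<close>

theorem pair_L1_tendsto_of_rational_boxes:
  fixes h0 :: "real^'n \<Rightarrow> real"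
  assumes h: "\<And>t. h t \<in> Sd" "h0 \<in> Sd"
    and boxes: "\<And>B. B \<in> rational_boxes \<Longrightarrow> ((\<lambda>t. pair_L1 (h t) (indicator B)) \<longlongrightarrow> pair_L1 h0 (indicator B)) F"
    and g: "integrable lborel g"
  shows "((\<lambda>t. pair_L1 (h t) g) \<longlongrightarrow> pair_L1 h0 g) F"
proof -
  define conv where "conv g \<longleftrightarrow> ((\<lambda>t. pair_L1 (h t) g) \<longlongrightarrow> pair_L1 h0 g) F" for g
  have conv_add: "conv (\<lambda>x. u x + v x)"
    if "integrable lborel u" "integrable lborel v" "conv u" "conv v" for u v
  proof -
    have "pair_L1 k (\<lambda>x. u x + v x) = pair_L1 k u + pair_L1 k v" if "k \<in> Sd" for k
      using integrable_Sd_mult[OF that] \<open>integrable lborel u\<close> \<open>integrable lborel v\<close>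
      by (simp add: pair_L1_def distrib_left)
    then show ?thesis using that(3,4) h by (simp add: conv_def tendsto_add)
  qed
  have conv_scale: "conv (\<lambda>x. u x * r)" if "conv u" for u r
    using tendsto_mult_right[OF that[unfolded conv_def], of r]
    by (simp add: conv_def pair_L1_def flip: mult.assoc)
  have conv_diff: "conv (\<lambda>x. u x - v x)"
    if "integrable lborel u" "integrable lborel v" "conv u" "conv v" for u v
    using conv_add[of u "\<lambda>x. v x * - 1"] conv_scale[of v "- 1"] that by simp
  have conv_zero: "conv (\<lambda>_. 0)" by (simp add: conv_def pair_L1_def)
  define Q :: "nat \<Rightarrow> (real^'n) set" where "Q N = box (\<chi> i. - real N) (\<chi> i. real N)" for N
  have Q: "Q N \<in> rational_boxes" for N
  proof -
    have "rational_vec ((\<chi> i. - real N) :: real^'n)" "rational_vec ((\<chi> i. real N) :: real^'n)"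
      by (simp_all add: rational_vec_def)
    then show ?thesis unfolding Q_def rational_boxes_def by blast
  qed
  have Qb: "Q N \<in> sets borel" for N by (simp add: Q_def)
  have intQ: "integrable lborel (indicator (Q N) :: _ \<Rightarrow> real)" for N by (simp add: Q_def)
  have intAQ: "integrable lborel (indicator (A \<inter> Q N) :: _ \<Rightarrow> real)" if "A \<in> sets borel" for A N
    by (rule Bochner_Integration.integrable_bound[OF intQ[of N]]) 
       (use that Qb in \<open>auto intro!: borel_measurable_indicator AE_I2 split: split_indicator\<close>)
  \<comment> \<open>The window \<open>Q N\<close> is itself a rational box, of finite measure.
    Complements are taken relative to it, since the complement of a set of finite measure has no
    integrable indicator.\<close>
  have bounded: "conv (indicator (A \<inter> Q N))" if A: "A \<in> sets borel" for A N
  proof -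
    note Int_stable_rational_boxes
    moreover have "rational_boxes \<subseteq> Pow (UNIV :: (real^'n) set)" by simp
    moreover have "A \<in> sigma_sets UNIV rational_boxes"
      using A unfolding borel_eq_sigma_rational_boxes by simp
    ultimately show ?thesis
    proof (induction rule: sigma_sets_induct_disjoint)
      case (basic A)
      then have "A \<inter> Q N \<in> rational_boxes" using Int_stable_rational_boxes Q by (auto simp: Int_stable_def)
      then show ?case using boxes by (simp add: conv_def)
    next
      case empty
      then show ?case using conv_zero by simp
    next
      case (compl A)
      then have "A \<in> sets borel" unfolding borel_eq_sigma_rational_boxes by simp
      moreover have "conv (indicator (Q N))" using boxes Q by (simp add: conv_def)
      ultimately have "conv (\<lambda>x. indicator (Q N) x - indicator (A \<inter> Q N) x)"
        using compl by (intro conv_diff intQ intAQ) auto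
      also have "(\<lambda>x. indicator (Q N) x - indicator (A \<inter> Q N) x :: real) = indicator ((UNIV - A) \<inter> Q N)"
        by (auto simp: indicator_def fun_eq_iff)
      finally show ?case .
    next
      case (union A)
      then have A: "A i \<in> sets borel" for i unfolding borel_eq_sigma_rational_boxes by auto
      have partial: "conv (indicator ((\<Union>i<n. A i) \<inter> Q N))" for n
      proof (induction n)
        case 0
        then show ?case using conv_zero by simp
      next
        case (Suc n)
        have "conv (\<lambda>x. indicator (A n \<inter> Q N) x + indicator ((\<Union>i<n. A i) \<inter> Q N) x)"
          using Suc union A by (intro conv_add intAQ) auto
        also have "(\<lambda>x. indicator (A n \<inter> Q N) x + indicator ((\<Union>i<n. A i) \<inter> Q N) x :: real)
            = indicator ((\<Union>i<Suc n. A i) \<inter> Q N)"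
        proof
          fix x
          have "x \<in> A n \<Longrightarrow> x \<notin> (\<Union>i<n. A i)" using union(1) unfolding disjoint_family_on_def
            by (metis IntI UN_E UNIV_I empty_iff lessThan_iff less_irrefl)
          then show "indicator (A n \<inter> Q N) x + indicator ((\<Union>i<n. A i) \<inter> Q N) x
            = (indicator ((\<Union>i<Suc n. A i) \<inter> Q N) x :: real)"
            by (auto simp: indicator_def lessThan_Suc)
        qed
        finally show ?case .
      qed
      show ?case
        unfolding conv_def
      proof (rule pair_L1_tendsto_dominated[OF h _ _ intQ[of N]])
        show "(\<lambda>n. indicator ((\<Union>i<n. A i) \<inter> Q N) x) \<longlonglongrightarrow> (indicator ((\<Union>i. A i) \<inter> Q N) x :: real)" for x
        proof (cases "x \<in> (\<Union>i. A i) \<inter> Q N")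
          case True
          then obtain m where "x \<in> A m" by auto
          have "\<forall>\<^sub>F n in sequentially. indicator ((\<Union>i<n. A i) \<inter> Q N) x = (1 :: real)"
            using eventually_gt_at_top[of m] 
          proof eventually_elim
            case (elim n)
            then show ?case using True \<open>x \<in> A m\<close> by (auto simp: indicator_def)
          qed
          then show ?thesis using True by (simp add: tendsto_eventually)
        next
          case False
          then have "x \<notin> (\<Union>i<n. A i) \<inter> Q N" for n by auto
          with False show ?thesis by simp
        qed
        show "((\<lambda>t. pair_L1 (h t) (indicator ((\<Union>i<n. A i) \<inter> Q N)))
            \<longlongrightarrow> pair_L1 h0 (indicator ((\<Union>i<n. A i) \<inter> Q N))) F" for n
          using partial by (simp add: conv_def)
      qed (use A Qb in \<open>auto split: split_indicator intro!: borel_measurable_indicator\<close>)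
    qed
  qed
  have finite: "conv (indicator A)" if A: "A \<in> sets borel" "emeasure lborel A < \<infinity>" for A
    unfolding conv_def
  proof (rule pair_L1_tendsto_dominated[OF h, where s = "\<lambda>N. indicator (A \<inter> Q N)" and w = "indicator A"])
    show "integrable lborel (indicator A :: _ \<Rightarrow> real)" using A by (simp add: integrable_indicator_iff)
    show "(\<lambda>N. indicator (A \<inter> Q N) x) \<longlonglongrightarrow> (indicator A x :: real)" for x
    proof -
      obtain m :: nat where "norm x < real m" using reals_Archimedean2 by blast
      have "x \<in> Q N" if "m \<le> N" for N
      proof -
        have "\<bar>x $ i\<bar> < real N" for i
          using component_le_norm_cart[of x i] \<open>norm x < real m\<close> of_nat_mono[OF that, where 'a = real] by linarith
        then show ?thesis by (simp add: Q_def mem_box_cart abs_less_iff minus_less_iff)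
      qed
      then have "\<forall>\<^sub>F N in sequentially. indicator (A \<inter> Q N) x = (indicator A x :: real)"
        by (auto simp: eventually_sequentially indicator_def)
      then show ?thesis by (rule tendsto_eventually)
    qed
    show "((\<lambda>t. pair_L1 (h t) (indicator (A \<inter> Q N))) \<longlongrightarrow> pair_L1 h0 (indicator (A \<inter> Q N))) F" for N
      using bounded[OF A(1)] by (simp add: conv_def)
  qed (use A Qb in \<open>auto split: split_indicator intro!: borel_measurable_indicator\<close>)
  have "conv g"
    using g
  proof (induction rule: integrable_induct)
    case (base A r)
    then show ?case using conv_scale[OF finite[of A]] by simp
  next
    case (add u v)
    then show ?case by (intro conv_add)
  next
    case (lim u s)
    show ?case
      unfolding conv_def
    proof (rule pair_L1_tendsto_dominated[OF h, where s = s and w = "\<lambda>x. 2 * \<bar>u x\<bar>"])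
      show "((\<lambda>t. pair_L1 (h t) (s j)) \<longlongrightarrow> pair_L1 h0 (s j)) F" for j
        using lim by (simp add: conv_def)
    qed (use lim in auto)
  qed
  then show ?thesis by (simp add: conv_def)
qed

text \<open>Passing from integer to real dilations rescales the box by the factor t / floor t, which tends to 1.\<close>
lemma pair_L1_dil_box_tendsto_at_top:
  fixes f :: "real^'n \<Rightarrow> real"
  assumes f: "f \<in> Sd"
    and lim: "(\<lambda>n. pair_L1 (dil (real (Suc n)) f) (indicator (box a b))) \<longlonglongrightarrow> l"
  shows "((\<lambda>t. pair_L1 (dil t f) (indicator (box a b))) \<longlongrightarrow> l) at_top"
proof -
  let ?B = "box a b"
  \<comment> \<open>Rounding down makes \<open>s t\<close> at least 1, so scaling by
    \<open>s t\<close> never shortens a vector and the growth condition holds with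
    \<open>C = 0\<close>.\<close>
  define m where "m t = nat \<lfloor>t\<rfloor>" for t :: real
  define s where "s t = t / real (m t)" for t
  have m: "0 < m t" "real (m t) \<le> t" "t < real (m t) + 1" if "1 \<le> t" for t
    using that by (simp_all add: m_def)
  have s: "1 \<le> s t" "s t \<le> 1 + 1 / real (m t)" if "1 \<le> t" for t
    using m[OF that] by (auto simp: s_def field_simps)
  have m_top: "filterlim m sequentially at_top"
    unfolding m_def by (rule filterlim_compose[OF filterlim_nat_sequentially filterlim_floor_sequentially])
  have s_lim: "(s \<longlongrightarrow> 1) at_top"
  proof (rule tendsto_sandwich)
    show "\<forall>\<^sub>F t in at_top. 1 \<le> s t" "\<forall>\<^sub>F t in at_top. s t \<le> 1 + 1 / real (m t)"
      using eventually_ge_at_top[of 1] by (eventually_elim, simp add: s)+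
    have "((\<lambda>n. 1 + 1 / real n) \<longlongrightarrow> 1 + 0) sequentially"
      by (intro tendsto_add tendsto_const lim_1_over_n)
    then show "((\<lambda>t. 1 + 1 / real (m t)) \<longlongrightarrow> 1) at_top"
      using filterlim_compose[OF _ m_top] by fastforce
  qed simp
  have "((\<lambda>t. pair_L1 (dil t f) (\<lambda>x. indicator ?B (s t *\<^sub>R x)) - pair_L1 (dil t f) (indicator ?B)) \<longlongrightarrow> 0) at_top"
  proof (rule pair_L1_box_perturbation[where C = 0])
    show "((\<lambda>t. s t *\<^sub>R x) \<longlongrightarrow> x) at_top" for x :: "real^'n"
      using tendsto_scaleR[OF s_lim tendsto_const, of x] by simp
    show "\<forall>\<^sub>F t in at_top. \<forall>x :: real^'n. norm x \<le> norm (s t *\<^sub>R x) + 0"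
      using eventually_ge_at_top[of 1]
    proof eventually_elim
      case (elim t)
      have "norm x \<le> \<bar>s t\<bar> * norm x" for x :: "real^'n"
        using s(1)[OF elim] mult_right_mono[of 1 "\<bar>s t\<bar>" "norm x"] by simp
      then show ?case by simp
    qed
  qed (use f in simp_all)
  moreover have "((\<lambda>t. pair_L1 (dil t f) (\<lambda>x. indicator ?B (s t *\<^sub>R x))) \<longlongrightarrow> l) at_top"
  proof -
    have "(\<lambda>n. pair_L1 (dil (real n) f) (indicator ?B)) \<longlonglongrightarrow> l"
      using lim by (rule LIMSEQ_imp_Suc)
    then have "((\<lambda>t. pair_L1 (dil (real (m t)) f) (indicator ?B)) \<longlongrightarrow> l) at_top"
      using m_top by (rule filterlim_compose)
    then have "((\<lambda>t. pair_L1 (dil (real (m t)) f) (indicator ?B) / s t ^ CARD('n)) \<longlongrightarrow> l / 1 ^ CARD('n)) at_top"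
      by (intro tendsto_divide tendsto_power s_lim) auto
    moreover have "\<forall>\<^sub>F t in at_top. pair_L1 (dil (real (m t)) f) (indicator ?B) / s t ^ CARD('n)
        = pair_L1 (dil t f) (\<lambda>x. indicator ?B (s t *\<^sub>R x))"
      using eventually_ge_at_top[of 1]
    proof eventually_elim
      case (elim t)
      have "dil (s t) (dil (real (m t)) f) = dil t f"
        using m[OF elim] by (simp add: dil_def s_def)
      moreover have "0 < s t" using s(1)[OF elim] by simp
      ultimately show ?case
        using pair_L1_dil_scaleR[OF dil_Sd[OF f, of "real (m t)"] integrable_indicator_box[of a b], of "s t"]
        by simp
    qed
    ultimately show ?thesis by (simp add: tendsto_cong)
  qed
  ultimately show ?thesis using tendsto_diff by fastforce
qed

text \<open>The right-hand side is a countable condition on measurable functionals, which is what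
  makes the event measurable. \<open>Suc n\<close> skips the dilation by 0, which reads
  \<open>f\<close> only at the origin and is outside the scope of
  \<open>pair_L1_dil_measurable\<close>.\<close>

lemma weak_star_tendsto_const_iff:
  fixes f :: "real^'n \<Rightarrow> real"
  assumes f: "f \<in> Sd" and c: "0 \<le> c" "c \<le> 1"
  shows "weak_star_tendsto_const f c \<longleftrightarrow>
    (\<forall>B\<in>rational_boxes. (\<lambda>n. pair_L1 (dil (real (Suc n)) f) (indicator B)) \<longlonglongrightarrow> pair_L1 (\<lambda>_. c) (indicator B))"
    (is "_ \<longleftrightarrow> ?R")
proof
  assume *: "weak_star_tendsto_const f c"
  have top: "filterlim (\<lambda>n. real (Suc n)) at_top sequentially"
    using filterlim_compose[OF filterlim_real_sequentially filterlim_Suc] .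
  show ?R
  proof
    fix B :: "(real^'n) set" assume "B \<in> rational_boxes"
    then have "integrable lborel (indicator B :: _ \<Rightarrow> real)" by (auto simp: rational_boxes_def)
    then have "((\<lambda>t. pair_L1 (dil t f) (indicator B)) \<longlongrightarrow> pair_L1 (\<lambda>_. c) (indicator B)) at_top"
      using * by (simp add: weak_star_tendsto_const_def)
    then show "(\<lambda>n. pair_L1 (dil (real (Suc n)) f) (indicator B)) \<longlonglongrightarrow> pair_L1 (\<lambda>_. c) (indicator B)"
      using top by (rule filterlim_compose)
  qed
next
  assume R: ?R
  have "(\<lambda>_. c) \<in> Sd" using c by (intro SdI) auto
  then show "weak_star_tendsto_const f c"
    unfolding weak_star_tendsto_const_def
  proof (intro allI impI, rule pair_L1_tendsto_of_rational_boxes[rotated])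
    fix B :: "(real^'n) set" assume "B \<in> rational_boxes"
    then show "((\<lambda>t. pair_L1 (dil t f) (indicator B)) \<longlongrightarrow> pair_L1 (\<lambda>_. c) (indicator B)) at_top"
      using R pair_L1_dil_box_tendsto_at_top[OF f] unfolding rational_boxes_def by blast
  qed (use f in auto)
qed

section \<open>Almost sure convergence\<close>

text \<open>The deterministic half of the argument. One \<open>m\<close> is fixed before
  \<open>t\<close> grows, so \<open>box_averaging (G m)\<close> is used with no uniformity in
  \<open>m\<close>. The three thirds of \<open>e\<close> pay for replacing the box average by the
  lattice mean of \<open>G m\<close>, for replacing \<open>G m\<close> by \<open>c\<close>, and for
  the lattice point count.\<close>

lemma box_average_tendsto_of_small_maximal:
  fixes f :: "real^'n \<Rightarrow> real"
  assumes f: "f \<in> Sd" and G: "\<And>m. box_averaging (G m)"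
    and small: "eventually (\<lambda>m. \<forall>n. (\<Sum>k\<in>icube (\<lambda>_. 0) n. \<bar>G m (transl (ivec k) f) - c\<bar>)
      \<le> (1 / 2) ^ m * real (2 * n + 1) ^ CARD('n)) sequentially"
  shows "((\<lambda>t. pair_L1 (dil t f) (indicator (box a b))) \<longlongrightarrow> c * measure lborel (box a b)) at_top"
proof (rule tendstoI)
  fix e :: real assume e: "0 < e"
  obtain R0 where R0: "\<And>x. x \<in> box a b \<Longrightarrow> norm x \<le> R0" using bounded_box[of a b] by (auto simp: bounded_iff)
  \<comment> \<open>An empty box admits a negative bound \<open>R0\<close>.\<close>
  define R where "R = max 0 R0"
  have R: "\<And>x. x \<in> box a b \<Longrightarrow> norm x \<le> R" "0 \<le> R" using R0 by (auto simp: R_def intro: max.coboundedI2)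
  \<comment> \<open>A cube of radius \<open>nat \<lceil>t * R\<rceil>\<close> has side at most
    \<open>2 * t * R + 3\<close>, hence at most \<open>t * (2 * R + 3)\<close> once \<open>t\<close>
    is at least 1.\<close>
  define C where "C = (2 * R + 3) ^ CARD('n)"
  have "((\<lambda>m. (1 / 2) ^ m * C) \<longlonglongrightarrow> 0 * C)"
    by (intro tendsto_mult tendsto_const LIMSEQ_power_zero) simp
  then have "\<forall>\<^sub>F m in sequentially. (1 / 2) ^ m * C < e / 3"
    using e by (intro order_tendstoD) auto
  with small have "\<forall>\<^sub>F m in sequentially. (1 / 2) ^ m * C < e / 3 \<and>
      (\<forall>n. (\<Sum>k\<in>icube (\<lambda>_. 0) n. \<bar>G m (transl (ivec k) f) - c\<bar>) \<le> (1 / 2) ^ m * real (2 * n + 1) ^ CARD('n))"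
    by eventually_elim simp
  then obtain m where m: "(1 / 2) ^ m * C < e / 3"
    and small_m: "\<And>n. (\<Sum>k\<in>icube (\<lambda>_. 0) n. \<bar>G m (transl (ivec k) f) - c\<bar>) \<le> (1 / 2) ^ m * real (2 * n + 1) ^ CARD('n)"
    by (auto simp: eventually_sequentially)
  have lattice: "\<bar>lattice_mean t a b (G m) f - c * (card (lattice_box t a b) / t ^ CARD('n))\<bar> \<le> (1 / 2) ^ m * C"
    if t: "1 \<le> t" for t
  proof -
    let ?K = "lattice_box t a b" and ?N = "nat \<lceil>t * R\<rceil>"
    have "\<bar>(\<Sum>k\<in>?K. G m (transl (ivec k) f)) - c * card ?K\<bar> = \<bar>\<Sum>k\<in>?K. G m (transl (ivec k) f) - c\<bar>"
      by (simp add: sum_subtractf mult.commute)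
    also have "\<dots> \<le> (\<Sum>k\<in>?K. \<bar>G m (transl (ivec k) f) - c\<bar>)" by (rule sum_abs)
    also have "\<dots> \<le> (\<Sum>k\<in>icube (\<lambda>_. 0) ?N. \<bar>G m (transl (ivec k) f) - c\<bar>)"
      using R t by (intro sum_mono2 lattice_box_subset) auto
    also have "\<dots> \<le> (1 / 2) ^ m * real (2 * ?N + 1) ^ CARD('n)" by (rule small_m)
    also have "\<dots> \<le> (1 / 2) ^ m * (t * (2 * R + 3)) ^ CARD('n)"
    proof (intro mult_left_mono power_mono)
      have "0 \<le> t * R" using R t by simp
      then have "real ?N \<le> t * R + 1" using of_int_ceiling_le_add_one[of "t * R"] by simp
      then show "real (2 * ?N + 1) \<le> t * (2 * R + 3)" using t by (simp add: distrib_left)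
    qed simp_all
    finally have *: "\<bar>(\<Sum>k\<in>?K. G m (transl (ivec k) f)) - c * card ?K\<bar> \<le> ((1 / 2) ^ m * C) * t ^ CARD('n)"
      by (simp add: C_def power_mult_distrib mult_ac)
    have "\<bar>lattice_mean t a b (G m) f - c * (card ?K / t ^ CARD('n))\<bar>
        = \<bar>(\<Sum>k\<in>?K. G m (transl (ivec k) f)) - c * card ?K\<bar> / t ^ CARD('n)"
      using t by (simp add: lattice_mean_def abs_divide flip: diff_divide_distrib)
    also have "\<dots> \<le> (1 / 2) ^ m * C" using * t by (simp add: pos_divide_le_eq)
    finally show ?thesis .
  qed
  have "\<forall>\<^sub>F t in at_top. dist (lattice_mean t a b (G m) f - pair_L1 (dil t f) (indicator (box a b))) 0 < e / 3"
    using G[of m] f e unfolding box_averaging_def by (intro tendstoD) auto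
  moreover have "\<forall>\<^sub>F t in at_top. dist (c * (card (lattice_box t a b) / t ^ CARD('n))) (c * measure lborel (box a b)) < e / 3"
    using e by (intro tendstoD tendsto_mult tendsto_const lattice_count_tendsto) auto
  ultimately show "\<forall>\<^sub>F t in at_top. dist (pair_L1 (dil t f) (indicator (box a b))) (c * measure lborel (box a b)) < e"
    using eventually_ge_at_top[of 1]
  proof eventually_elim
    case (elim t)
    then show ?case using lattice[of t] m unfolding dist_real_def by linarith
  qed
qed

section \<open>Measurability and range of the pairings\<close>

lemma space_Sd_measure: "space Sd_measure = Sd"
  by (simp add: Sd_measure_def space_measure_of_conv)

lemma pair_L1_measurable:
  assumes "integrable lborel g" "sets M = sets Sd_measure"
  shows "(\<lambda>f. pair_L1 f g) \<in> borel_measurable M"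
proof -
  let ?E = "\<Union>g\<in>{g. integrable lborel g}. {(\<lambda>f. pair_L1 f g) -` B \<inter> Sd | B. B \<in> sets borel}"
  have "sets Sd_measure = sigma_sets Sd ?E"
    unfolding Sd_measure_def by (rule sets_measure_of) auto
  then have "(\<lambda>f. pair_L1 f g) -` B \<inter> Sd \<in> sets Sd_measure" if "B \<in> sets borel" for B
    using assms(1) that by (auto intro!: sigma_sets.Basic)
  then have "(\<lambda>f. pair_L1 f g) \<in> borel_measurable Sd_measure"
    by (intro measurableI) (simp_all add: space_Sd_measure)
  then show ?thesis using measurable_cong_sets[OF assms(2) refl] by blast
qed

text \<open>The dilation is moved onto the test function, which leaves one of the pairings that
  generate the sigma-algebra, up to a constant factor.\<close>

lemma pair_L1_dil_measurable:
  assumes g: "integrable lborel g" and M: "sets M = sets Sd_measure" and t: "0 < t"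
  shows "(\<lambda>f :: real^'n \<Rightarrow> real. pair_L1 (dil t f) g) \<in> borel_measurable M"
proof -
  have int: "integrable lborel (\<lambda>x. g ((1 / t) *\<^sub>R x))" using g t by (intro integrable_lborel_scaleR) auto
  have "space M = Sd" using sets_eq_imp_space_eq[OF M] by (simp add: space_Sd_measure)
  then have "pair_L1 (dil t f) g = pair_L1 f (\<lambda>x. g ((1 / t) *\<^sub>R x)) / t ^ CARD('n)" if "f \<in> space M" for f
    using pair_L1_dil_scaleR[OF _ int t, of f] that t by simp
  moreover have "(\<lambda>f. pair_L1 f (\<lambda>x. g ((1 / t) *\<^sub>R x)) / t ^ CARD('n)) \<in> borel_measurable M"
    by (intro borel_measurable_divide borel_measurable_const pair_L1_measurable[OF int M])
  ultimately show ?thesis by (simp cong: measurable_cong)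
qed

lemma cell_mean_range:
  fixes f :: "real^'n \<Rightarrow> real"
  assumes f: "f \<in> Sd"
  shows "cell_mean f \<in> {0..1}"
proof -
  note int = integrable_Sd_mult[OF f integrable_unit_cell]
  have "0 \<le> cell_mean f"
    unfolding cell_mean_def pair_L1_def by (rule Bochner_Integration.integral_nonneg) (simp add: SdD[OF f])
  moreover have "cell_mean f \<le> cell_mean (\<lambda>_ :: real^'n. 1)"
    unfolding cell_mean_def pair_L1_def
    by (rule integral_mono[OF int]) (use integrable_unit_cell SdD[OF f] in \<open>auto split: split_indicator\<close>)
  ultimately show ?thesis by (simp add: cell_mean_one)
qed

text \<open>The quantifier over boxes stands inside the almost sure statement: the exceptional
  events \<open>A m\<close> come from cubes around the origin and do not depend on \<open>a\<close>
  and \<open>b\<close>, so one null set serves the uncountably many boxes.\<close>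

theorem AE_box_averages_tendsto:
  fixes M :: "(real^'n \<Rightarrow> real) measure"
  assumes erg: "ergodic_transl M"
  shows "AE f in M. \<forall>a b. ((\<lambda>t. pair_L1 (dil t f) (indicator (box a b)))
    \<longlongrightarrow> (\<integral>h. cell_mean h \<partial>M) * measure lborel (box a b)) at_top"
proof -
  have tinv: "transl_invariant M" using erg by (simp add: ergodic_transl_def)
  then interpret prob_space M by (simp add: transl_invariant_def)
  have sets: "sets M = sets Sd_measure" and T: "\<And>v. transl v \<in> M \<rightarrow>\<^sub>M M" and distr: "\<And>v. distr M M (transl v) = M"
    using tinv by (auto simp: transl_invariant_def)
  have space: "space M = Sd" using sets_eq_imp_space_eq[OF sets] by (simp add: space_Sd_measure)
  define c where "c = expectation cell_mean"
  \<comment> \<open>Membership is by properties, so that convex combinations of translates never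
    have to be written out; it is enough that \<open>cell_mean\<close> belongs to \<open>F\<close>
    and that the closure conditions hold.\<close>
  define F where "F = {G. G \<in> borel_measurable M \<and> (\<forall>f\<in>Sd. G f \<in> {0..1}) \<and> expectation G = c \<and> box_averaging G}"
  have cell: "(cell_mean :: (real^'n \<Rightarrow> real) \<Rightarrow> real) \<in> F"
    unfolding F_def c_def mem_Collect_eq cell_mean_def[abs_def]
    using pair_L1_measurable[OF integrable_unit_cell sets] cell_mean_range box_averaging_cell_mean
    by (auto simp: cell_mean_def[abs_def])
  \<comment> \<open>The rate \<open>(1 / 4) ^ m\<close> is set against the threshold
    \<open>(1 / 2) ^ m\<close> in \<open>A m\<close>: their quotient is summable, as Borel-Cantelli
    requires, while the threshold still tends to 0.\<close>
  have "\<exists>G\<in>F. expectation (\<lambda>x. \<bar>G x - c\<bar>) < (1 / 4) ^ m" for m :: nat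
  proof (rule mean_ergodic_midpoint_family[OF T distr])
    show "prob A = 0 \<or> prob A = 1" if "A \<in> events"
      "\<And>v. (transl v -` A \<inter> space M - A) \<union> (A - (transl v -` A \<inter> space M)) \<in> null_sets M" for A
      using erg that by (auto simp: ergodic_transl_def)
    show "F \<noteq> {}" using cell by blast
    show "(\<lambda>f. G (transl v f)) \<in> F" if "G \<in> F" for G v
    proof -
      have [measurable]: "G \<in> borel_measurable M" using that by (simp add: F_def)
      have "expectation (\<lambda>f. G (transl v f)) = expectation G"
        using integral_distr[OF T[of v], of G] distr[of v] by simp
      then show ?thesis
        using that measurable_compose[OF T[of v], of G borel] box_averaging_transl[of G v] by (simp add: F_def)
    qed
    show "(\<lambda>f. (G f + H f) / 2) \<in> F" if "G \<in> F" "H \<in> F" for G H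
    proof -
      have GH: "G \<in> borel_measurable M" "H \<in> borel_measurable M" "\<And>f. f \<in> Sd \<Longrightarrow> 0 \<le> G f" "\<And>f. f \<in> Sd \<Longrightarrow> G f \<le> 1"
        "\<And>f. f \<in> Sd \<Longrightarrow> 0 \<le> H f" "\<And>f. f \<in> Sd \<Longrightarrow> H f \<le> 1"
        using that by (auto simp: F_def)
      have "integrable M G" "integrable M H"
        by (rule integrable_const_bound[where B = 1]; use GH space in \<open>auto intro!: AE_I2\<close>)+
      then have "expectation (\<lambda>f. (G f + H f) / 2) = c"
        using that by (simp add: F_def)
      moreover have "(\<lambda>f. (G f + H f) / 2) \<in> borel_measurable M"
        using GH by (intro borel_measurable_divide borel_measurable_add borel_measurable_const)
      moreover have "(G f + H f) / 2 \<in> {0..1}" if "f \<in> Sd" for f using GH(3-)[OF that] by simp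
      moreover have "box_averaging (\<lambda>f. (G f + H f) / 2)"
        using that by (intro box_averaging_midpoint) (auto simp: F_def)
      ultimately show ?thesis unfolding F_def by blast
    qed
  qed (auto simp: F_def space)
  then obtain G where GF: "\<And>m. G m \<in> F" and G: "\<And>m. expectation (\<lambda>x. \<bar>G m x - c\<bar>) < (1 / 4) ^ m" by metis
  have G_meas [measurable]: "G m \<in> borel_measurable M" for m using GF[of m] by (simp add: F_def)
  have G_avg: "box_averaging (G m)" for m using GF[of m] by (simp add: F_def)
  have T' [measurable]: "transl (ivec k) \<in> M \<rightarrow>\<^sub>M M" for k by (rule T)
  define A where "A m = {f \<in> space M. \<exists>n. (1 / 2) ^ m * real (2 * n + 1) ^ CARD('n)
    < (\<Sum>k\<in>icube (\<lambda>_. 0) n. \<bar>G m (transl (ivec k) f) - c\<bar>)}" for m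
  have A [measurable]: "A m \<in> events" for m unfolding A_def by measurable
  have A_le: "prob (A m) \<le> 4 ^ CARD('n) * (1 / 2) ^ m" for m
  proof -
    have int: "integrable M (\<lambda>f. \<bar>G m f - c\<bar>)"
    proof (intro integrable_abs Bochner_Integration.integrable_diff integrable_const)
      show "integrable M (G m)"
        by (rule integrable_const_bound[where B = 1]) (use GF[of m] space in \<open>auto simp: F_def intro!: AE_I2\<close>)
    qed
    have "prob (A m) \<le> 4 ^ CARD('n) * expectation (\<lambda>f. \<bar>G m f - c\<bar>) / (1 / 2) ^ m"
      unfolding A_def
      by (rule maximal_inequality_icube[OF T' distr _ int]) (simp_all add: transl_transl ivec_add)
    also have "\<dots> \<le> 4 ^ CARD('n) * (1 / 4) ^ m / (1 / 2) ^ m"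
      by (intro divide_right_mono mult_left_mono less_imp_le[OF G]) simp_all
    also have "\<dots> = 4 ^ CARD('n) * (1 / 2) ^ m"
    proof -
      have "(1 / 4 :: real) ^ m = (1 / 2) ^ m * (1 / 2) ^ m" by (simp flip: power_mult_distrib)
      then show ?thesis by simp
    qed
    finally show ?thesis .
  qed
  have "AE f in M. eventually (\<lambda>m. f \<in> space M - A m) sequentially"
  proof (rule borel_cantelli_AE1[OF A])
    show "summable (\<lambda>m. prob (A m))"
      by (rule summable_comparison_test'[where g = "\<lambda>m. 4 ^ CARD('n) * (1 / 2) ^ m"])
        (use A_le in \<open>auto intro!: summable_mult summable_geometric\<close>)
  qed (simp add: emeasure_eq_measure)
  then show ?thesis
    using AE_space
  proof eventually_elim
    case (elim f)
    have "f \<in> Sd" using elim space by simp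
    moreover have "\<forall>\<^sub>F m in sequentially. \<forall>n. (\<Sum>k\<in>icube (\<lambda>_. 0) n. \<bar>G m (transl (ivec k) f) - c\<bar>)
        \<le> (1 / 2) ^ m * real (2 * n + 1) ^ CARD('n)"
      using elim(1) by eventually_elim (simp add: A_def not_less)
    ultimately show ?case
      unfolding c_def[symmetric] by (intro allI box_average_tendsto_of_small_maximal[OF _ G_avg])
  qed
qed

theorem theorem2p3:
  fixes M :: "(real^'n \<Rightarrow> real) measure"
  assumes "ergodic_transl M"
  defines "c \<equiv> (\<integral>h. (LINT x:cbox 0 One|lborel. h x) \<partial>M)"
  shows "measure M {f \<in> space M. weak_star_tendsto_const f c} = 1"
proof -
  have tinv: "transl_invariant M" using assms(1) by (simp add: ergodic_transl_def)
  then interpret prob_space M by (simp add: transl_invariant_def)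
  have sets: "sets M = sets Sd_measure" using tinv by (simp add: transl_invariant_def)
  have space: "space M = Sd" using sets_eq_imp_space_eq[OF sets] by (simp add: space_Sd_measure)
  have c: "c = expectation cell_mean"
    unfolding c_def by (intro Bochner_Integration.integral_cong) (simp_all add: space cell_mean_eq)
  have [measurable]: "(cell_mean :: (real^'n \<Rightarrow> real) \<Rightarrow> real) \<in> borel_measurable M"
    unfolding cell_mean_def[abs_def] by (rule pair_L1_measurable[OF integrable_unit_cell sets])
  have range: "0 \<le> cell_mean f" "cell_mean f \<le> 1" if "f \<in> space M" for f
    using cell_mean_range[of f] that space by auto
  have "integrable M cell_mean"
    by (rule integrable_const_bound[where B = 1]) (use range in \<open>auto intro!: AE_I2\<close>)
  then have c01: "0 \<le> c" "c \<le> 1"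
    unfolding c using range by (auto intro!: integral_ge_const integral_le_const AE_I2)
  let ?W = "{f \<in> space M. weak_star_tendsto_const f c}"
  \<comment> \<open>\<open>measure\<close> is 0 on sets outside \<open>events\<close>, so almost
    sure convergence alone would not give the value 1; \<open>?W\<close> has to be shown measurable
    as well.\<close>
  have W: "?W = {f \<in> space M. \<forall>B\<in>rational_boxes.
      (\<lambda>n. pair_L1 (dil (real (Suc n)) f) (indicator B)) \<longlonglongrightarrow> pair_L1 (\<lambda>_. c) (indicator B)}"
    using weak_star_tendsto_const_iff[OF _ c01] space by blast
  have "?W \<in> events"
    unfolding W
  proof (rule sets.sets_Collect_countable_All'[OF _ countable_rational_boxes])
    fix B :: "(real^'n) set" assume "B \<in> rational_boxes"
    then have B: "integrable lborel (indicator B :: _ \<Rightarrow> real)" by (auto simp: rational_boxes_def)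
    have [measurable]: "(\<lambda>f. pair_L1 (dil (real (Suc n)) f) (indicator B)) \<in> borel_measurable M" for n
      by (rule pair_L1_dil_measurable[OF B sets]) simp
    show "{f \<in> space M. (\<lambda>n. pair_L1 (dil (real (Suc n)) f) (indicator B)) \<longlonglongrightarrow> pair_L1 (\<lambda>_. c) (indicator B)} \<in> events"
      by measurable
  qed
  moreover have "AE f in M. f \<in> ?W"
    using AE_box_averages_tendsto[OF assms(1)] AE_space
  proof eventually_elim
    case (elim f)
    have top: "filterlim (\<lambda>n. real (Suc n)) at_top sequentially"
      by (rule filterlim_compose[OF filterlim_real_sequentially filterlim_Suc])
    have "(\<lambda>n. pair_L1 (dil (real (Suc n)) f) (indicator B)) \<longlonglongrightarrow> pair_L1 (\<lambda>_. c) (indicator B)"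
      if B: "B \<in> rational_boxes" for B
    proof -
      obtain a b where "B = box a b" using B by (auto simp: rational_boxes_def)
      moreover have "pair_L1 (\<lambda>_. c) (indicator (box a b)) = c * measure lborel (box a b)"
        by (simp add: pair_L1_def)
      ultimately show ?thesis
        using filterlim_compose[OF elim(1)[rule_format, of a b] top] by (simp add: c)
    qed
    then show ?case using elim(2) unfolding W by blast
  qed
  ultimately show ?thesis by (simp add: prob_eq_1)
qed

end
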